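(* For any integer $k\ge 2$, the proportion of $n$-vertex trees containing $k$ pairwise non-similar cospectral vertices (that is, $k$ vertices that are pairwise cospectral and pairwise non-similar in the tree) approaches $1$ as $n\to\infty$.
   Context: Trees are finite and unrooted, and $n$-vertex trees are counted up to isomorphism. The characteristic polynomial of a graph $G$ with adjacency matrix $A$ is $\phi(G)=\det(xI-A)$. For a vertex $u$, $G\backslash u$ is the graph obtained by deleting $u$ and all incident edges. Two vertices $u,u'$ of $G$ are cospectral if $\phi(G\backslash u)=\phi(G\backslash u')$. Two vertices of $G$ are similar if there is an automorphism of $G$ taking one to the other. *)

theory Defs
  imports
    Complex_Main
    "Graph_Theory.Graph_Theory"
    "Jordan_Normal_Form.Char_Poly"
begin

text \<open>
  Finite simple graphs are loop-free symmetric digraphs without parallel arcs (\<^locale>\<open>pair_graph\<close>).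
  The library predicate \<^const>\<open>tree\<close> cannot be used for them: its notion of cycle is the directed
  one, under which the two arcs of a single undirected edge already form a cycle. Cycles of an
  undirected simple graph are the directed cycles of length at least 3.
\<close>

definition undirected_tree :: "'a pair_pre_digraph \<Rightarrow> bool" where
  "undirected_tree G \<longleftrightarrow>
     pair_graph G \<and> connected (with_proj G) \<and>
     \<not> (\<exists>p. pre_digraph.cycle (with_proj G) p \<and> 3 \<le> length p)"

definition trees :: "nat \<Rightarrow> nat pair_pre_digraph set" where
  "trees n = {T. undirected_tree T \<and> pverts T = {..<n}}"

definition tree_iso :: "nat \<Rightarrow> nat pair_pre_digraph rel" where
  "tree_iso n = {(S, T). S \<in> trees n \<and> T \<in> trees n \<and> digraph_iso (with_proj S) (with_proj T)}"

lemma equiv_tree_iso: "equiv (trees n) (tree_iso n)"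
proof (rule equivI)
  show "tree_iso n \<subseteq> trees n \<times> trees n"
    by (auto simp: tree_iso_def)
  have wf: "wf_digraph (with_proj T)" if "T \<in> trees n" for T
    using that by (simp add: trees_def undirected_tree_def wf_digraph_wp_iff pair_graph_def
        pair_digraph_def pair_fin_digraph_def)
  have "digraph_iso (with_proj T) (with_proj T)" if "T \<in> trees n" for T
    unfolding digraph_iso_def
    by (rule exI[of _ "\<lparr>iso_verts = id, iso_arcs = id, iso_head = snd, iso_tail = fst\<rparr>"])
      (simp add: pre_digraph.digraph_isomorphism_def app_iso_def with_proj_def wf[OF that, unfolded with_proj_def])
  then show "refl_on (trees n) (tree_iso n)"
    by (auto simp: refl_on_def tree_iso_def)
  show "sym (tree_iso n)"
    by (auto simp: sym_def tree_iso_def intro: digraph_iso_swap wf)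
  show "trans (tree_iso n)"
    by (auto simp: trans_def tree_iso_def intro: digraph_iso_trans)
qed

text \<open>
  The vertices are listed in increasing order only to index the matrix; the characteristic
  polynomial does not depend on this choice.
\<close>

definition adjacency_mat :: "('a::linorder, 'b) pre_digraph \<Rightarrow> int mat" where
  "adjacency_mat G =
     (let vs = sorted_list_of_set (verts G)
      in mat (length vs) (length vs) (\<lambda>(i, j). if vs ! i \<rightarrow>\<^bsub>G\<^esub> vs ! j then 1 else 0))"

definition graph_char_poly :: "('a::linorder, 'b) pre_digraph \<Rightarrow> int poly" where
  "graph_char_poly G = char_poly (adjacency_mat G)"

definition cospectral_verts :: "('a::linorder) pair_pre_digraph \<Rightarrow> 'a \<Rightarrow> 'a \<Rightarrow> bool" where
  "cospectral_verts G u v \<longleftrightarrow>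
     graph_char_poly (pre_digraph.del_vert (with_proj G) u) =
     graph_char_poly (pre_digraph.del_vert (with_proj G) v)"

definition similar_verts :: "'a pair_pre_digraph \<Rightarrow> 'a \<Rightarrow> 'a \<Rightarrow> bool" where
  "similar_verts G u v \<longleftrightarrow>
     (\<exists>f. pre_digraph.digraph_isomorphism (with_proj G) f \<and>
          app_iso f (with_proj G) = with_proj G \<and> iso_verts f u = v)"

definition has_nonsimilar_cospectral_verts :: "nat \<Rightarrow> ('a::linorder) pair_pre_digraph \<Rightarrow> bool" where
  "has_nonsimilar_cospectral_verts k G \<longleftrightarrow>
     (\<exists>U \<subseteq> pverts G. card U = k \<and>
        (\<forall>u\<in>U. \<forall>v\<in>U. u \<noteq> v \<longrightarrow> cospectral_verts G u v \<and> \<not> similar_verts G u v))"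

text \<open>
  Proportion of \<open>n\<close>-vertex trees, counted up to isomorphism, satisfying an isomorphism-invariant
  property.
\<close>

definition tree_proportion :: "(nat pair_pre_digraph \<Rightarrow> bool) \<Rightarrow> nat \<Rightarrow> real" where
  "tree_proportion P n =
     real (card ({T \<in> trees n. P T} // tree_iso n)) / real (card (trees n // tree_iso n))"

end

theory Submission
  imports Defs "HOL-Library.Multiset" "HOL-Real_Asymp.Real_Asymp"
begin

text \<open>
  Hang \<open>k\<close> pairwise non-isomorphic rooted trees, all with the same characteristic polynomial before and
  after deletion of the root, below a common vertex. In every host the roots of these branches are
  cospectral, because the characteristic polynomial of the host is determined by those two
  polynomials of each branch; and they are not similar once the host is more than twice as large as
  a branch. Let \<open>L\<close> be the resulting rooted tree. It remains to see that almost all trees contain \<open>L\<close> as a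
  limb (Schwenk).

  This is counted without generating functions. Write \<open>t\<^sub>n\<close> for the number of rooted trees with \<open>n\<close> vertices
  and call two vertices of a rooted tree equivalent if an automorphism takes one to the other. Few rooted
  trees have fewer than \<open>m = n\<^bsup>3/4\<^esup>\<close> classes of vertices: at most \<open>m n\<^bsup>2m\<^esup>\<close>, whereas \<open>t\<^sub>n\<close> grows exponentially.
  A tree that avoids \<open>L\<close> and has \<open>m\<close> classes gives \<open>m\<close> different trees by attaching a fixed branch
  containing \<open>L\<close> at one of its vertices, and it can be recovered from each of them. Doing this twice gains
  \<open>m\<^sup>2 \<ge> n\<^bsup>3/2\<^esup>\<close>, while the bounded increase in size costs only a power of \<open>log n\<close>, since
  \<open>t\<^bsub>n+1\<^esub> = O(t\<^sub>n log n)\<close>. The gain beats the factor \<open>n\<close> between rooted and unrooted trees.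
\<close>

subsection \<open>Rooted trees\<close>

text \<open>Branches form a multiset, so equality of terms is isomorphism of rooted trees and
  \<open>card\<close> counts isomorphism classes.\<close>

datatype rtree = Node (children: "rtree multiset")

primrec tree_size :: "rtree \<Rightarrow> nat" where
  "tree_size (Node M) = Suc (\<Sum>\<^sub># (image_mset tree_size M))"

text \<open>Only full subtrees occur here: a vertex together with all its descendants.\<close>

primrec subtrees :: "rtree \<Rightarrow> rtree set" where
  "subtrees (Node M) = insert (Node M) (\<Union> (set_mset (image_mset subtrees M)))"

definition rooted_trees :: "nat \<Rightarrow> rtree set" where
  "rooted_trees n = {t. tree_size t = n}"

lemma tree_size_pos [simp]: "0 < tree_size t"
  by (cases t) simp

lemma tree_size_neq_0 [simp]: "tree_size t \<noteq> 0"
  by (cases t) simp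

lemma tree_size_child: "c \<in># M \<Longrightarrow> tree_size c < tree_size (Node M)"
  by (auto dest!: multi_member_split)

lemma subtrees_self [simp]: "t \<in> subtrees t"
  by (cases t) simp

lemma subtrees_trans: "s \<in> subtrees t \<Longrightarrow> t \<in> subtrees u \<Longrightarrow> s \<in> subtrees u"
  by (induction u) auto

lemma subtrees_size: "s \<in> subtrees t \<Longrightarrow> s = t \<or> tree_size s < tree_size t"
proof (induction t)
  case (Node M)
  then show ?case
    using tree_size_child[of _ M] by (force simp del: tree_size.simps)
qed

lemma rtree_attach_cases:
  obtains "t = Node {#}" | c M where "t = Node (add_mset c M)"
  by (cases t; metis multiset_cases)

lemma finite_rooted_trees [simp]: "finite (rooted_trees n)"
proof (induction n rule: less_induct)
  case (less n)
  let ?F = "\<Union>k<n. rooted_trees k"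
  have "rooted_trees n \<subseteq> insert (Node {#}) ((\<lambda>(c, t). Node (add_mset c (children t))) ` (?F \<times> ?F))"
  proof
    fix t assume t: "t \<in> rooted_trees n"
    show "t \<in> insert (Node {#}) ((\<lambda>(c, t). Node (add_mset c (children t))) ` (?F \<times> ?F))"
    proof (cases t rule: rtree_attach_cases)
      case (2 c M)
      then have "tree_size c < n" "tree_size (Node M) < n"
        using t by (auto simp: rooted_trees_def)
      then show ?thesis using 2
        by (intro insertI2 image_eqI[of _ _ "(c, Node M)"]) (auto simp: rooted_trees_def simp del: tree_size.simps)
    qed simp
  qed
  then show ?case using less by (auto intro: finite_subset)
qed

lemma finite_size_le: "finite {t. tree_size t \<le> n}"
proof -
  have "{t. tree_size t \<le> n} = (\<Union>k\<le>n. rooted_trees k)" by (auto simp: rooted_trees_def)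
  then show ?thesis by simp
qed

subsection \<open>Growth of the number of rooted trees\<close>

lemma card_rooted_trees_1 [simp]: "card (rooted_trees (Suc 0)) = 1"
proof -
  have "rooted_trees (Suc 0) = {Node {#}}"
  proof -
    have "t = Node {#}" if "tree_size t = Suc 0" for t
      using that by (cases t rule: rtree_attach_cases) auto
    then show ?thesis by (auto simp: rooted_trees_def)
  qed
  then show ?thesis by simp
qed

text \<open>Two vertices are added in two ways. The new root has one child in the first and two in
  the second, so the images are disjoint.\<close>

lemma card_rooted_trees_2: "2 * card (rooted_trees n) \<le> card (rooted_trees (n + 2))" if "n \<ge> 1"
proof -
  let ?f = "\<lambda>t. Node {#Node {#t#}#}" and ?g = "\<lambda>t. Node {#t, Node {#}#}"
  have "inj_on ?f (rooted_trees n)" "inj_on ?g (rooted_trees n)"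
    by (auto intro!: inj_onI simp: add_eq_conv_ex)
  moreover have "?f ` rooted_trees n \<inter> ?g ` rooted_trees n = {}" by auto
  ultimately have "2 * card (rooted_trees n) = card (?f ` rooted_trees n \<union> ?g ` rooted_trees n)"
    by (subst card_Un_disjoint) (auto simp: card_image)
  also have "\<dots> \<le> card (rooted_trees (n + 2))"
    by (rule card_mono[OF finite_rooted_trees]) (auto simp: rooted_trees_def)
  finally show ?thesis .
qed

text \<open>The rate is immaterial: any exponential lower bound outgrows the subexponential count of
  trees with few orbits.\<close>

lemma card_rooted_trees_ge: "2 ^ ((n - 1) div 2) \<le> card (rooted_trees n)" if "n \<ge> 1"
  using that
proof (induction n rule: less_induct)
  case (less n)
  consider "n = 1" | "n = 2" | m where "n = m + 2" "m \<ge> 1"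
    using less.prems by (metis add.commute le_add_diff_inverse nat_le_linear not_less_eq_eq numeral_2_eq_2 le_antisym One_nat_def diff_is_0_eq' le_zero_eq nat_neq_iff Suc_leI zero_less_diff)
  then show ?case
  proof cases
    case 2
    have "Node {#Node {#}#} \<in> rooted_trees 2" by (simp add: rooted_trees_def)
    then have "card (rooted_trees 2) > 0" by (metis card_gt_0_iff empty_iff finite_rooted_trees)
    then show ?thesis using 2 by simp
  next
    case 3
    then have "(n - 1) div 2 = Suc ((m - 1) div 2)" by simp
    then show ?thesis using less.IH[of m] card_rooted_trees_2[of m] 3 by simp
  qed simp
qed

lemma card_rooted_trees_pos: "n \<ge> 1 \<Longrightarrow> 0 < card (rooted_trees n)"
  using card_rooted_trees_ge[of n] by (metis gr0I not_less power_eq_0_iff zero_neq_numeral le_zero_eq)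

text \<open>
  A tree of size \<open>n + 1\<close> has a unary root, or a leaf below the root, or a smallest branch of size
  \<open>j\<close> with \<open>2 \<le> j \<le> n / 2\<close>. In the last case shrinking that branch by one vertex
  makes it the unique smallest one, so the number of choices is governed by the ratio at \<open>j - 1\<close>.
\<close>
lemma card_rooted_trees_Suc:
  "n \<ge> 1 \<Longrightarrow> n < 2 ^ q \<Longrightarrow> card (rooted_trees (Suc n)) \<le> 2 * q * card (rooted_trees n)"
proof (induction q arbitrary: n)
  case 0
  then show ?case by simp
next
  case (Suc q)
  \<comment> \<open>In a pair \<open>(j, M)\<close>, \<open>j\<close> is the size of a smallest
    branch, which has been removed, and \<open>M\<close> holds the remaining branches.\<close>
  define I where "I = {(j, M). 2 \<le> j \<and> M \<noteq> {#} \<and> (\<forall>c\<in>#M. j \<le> tree_size c)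
      \<and> j + tree_size (Node M) = Suc n}"
  define A where "A = (\<lambda>t. Node {#t#}) ` rooted_trees n"
  define B where "B = (\<lambda>t. Node (add_mset (Node {#}) (children t))) ` rooted_trees n"
  define D where "D = (\<lambda>((j, M), S). Node (add_mset S M)) ` (SIGMA i:I. rooted_trees (fst i))"
  have finI: "finite I"
  proof (rule finite_subset)
    show "I \<subseteq> {..Suc n} \<times> children ` {t. tree_size t \<le> Suc n}"
    proof
      fix i assume "i \<in> I"
      then obtain j M where i: "i = (j, M)" "(j, M) \<in> I" by (cases i) auto
      then show "i \<in> {..Suc n} \<times> children ` {t. tree_size t \<le> Suc n}"
        by (auto simp: I_def intro!: image_eqI[of _ children "Node M"])
    qed
    show "finite ({..Suc n} \<times> children ` {t. tree_size t \<le> Suc n})"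
      using finite_size_le by blast
  qed
  have "rooted_trees (Suc n) \<subseteq> A \<union> B \<union> D"
  proof
    fix t assume t: "t \<in> rooted_trees (Suc n)"
    obtain M where M: "t = Node M" by (cases t)
    have "M \<noteq> {#}" using t M \<open>n \<ge> 1\<close> by (auto simp: rooted_trees_def)
    then obtain S where S: "S \<in># M" "\<forall>c\<in>#M. tree_size S \<le> tree_size c"
      using ex_has_least_nat[of "\<lambda>c. c \<in># M" _ tree_size] by (metis multiset_nonemptyE)
    define M' where "M' = M - {#S#}"
    have M': "M = add_mset S M'" using S by (simp add: M'_def)
    show "t \<in> A \<union> B \<union> D"
    proof (cases "M' = {#}")
      case True
      then show ?thesis using t M M' by (auto simp: A_def rooted_trees_def)
    next
      case ne: False
      show ?thesis
      proof (cases "tree_size S = 1")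
        case True
        then have "S = Node {#}" by (cases S rule: rtree_attach_cases) auto
        then have "t \<in> B" using t M M' by (auto simp: B_def rooted_trees_def intro!: image_eqI[of _ _ "Node M'"])
        then show ?thesis by simp
      next
        case False
        then have "2 \<le> tree_size S" using tree_size_pos[of S] by linarith
        then have "(tree_size S, M') \<in> I"
          using ne S t M M' by (auto simp: I_def rooted_trees_def)
        then have "t \<in> D" using M M' by (force simp: D_def rooted_trees_def)
        then show ?thesis by simp
      qed
    qed
  qed
  moreover have "finite (A \<union> B \<union> D)" using finI by (auto simp: A_def B_def D_def)
  ultimately have "card (rooted_trees (Suc n)) \<le> card (A \<union> B \<union> D)" by (rule card_mono[rotated])
  also have "\<dots> \<le> card A + card B + card D"
    by (meson add_le_mono card_Un_le le_refl le_trans)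
  also have "card A \<le> card (rooted_trees n)" unfolding A_def by (rule card_image_le) simp
  also have "card B \<le> card (rooted_trees n)" unfolding B_def by (rule card_image_le) simp
  also have "card D \<le> 2 * q * card (rooted_trees n)"
  proof -
    let ?S = "SIGMA i:I. rooted_trees (fst i - 1)"
    have "card D \<le> card (SIGMA i:I. rooted_trees (fst i))"
      unfolding D_def using finI by (intro card_image_le) auto
    also have "\<dots> = (\<Sum>i\<in>I. card (rooted_trees (fst i)))" using finI by (simp add: card_SigmaI)
    also have "\<dots> \<le> (\<Sum>i\<in>I. 2 * q * card (rooted_trees (fst i - 1)))"
    proof (rule sum_mono)
      fix i assume "i \<in> I"
      then obtain j M where i: "i = (j, M)" "2 \<le> j" "M \<noteq> {#}" "\<forall>c\<in>#M. j \<le> tree_size c"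
        "j + tree_size (Node M) = Suc n" by (auto simp: I_def)
      obtain c M0 where "M = add_mset c M0" using i by (metis multiset_cases)
      \<comment> \<open>Some remaining branch has at least \<open>j\<close> vertices, so
        \<open>j\<close> is at most half of \<open>n\<close>. This halving lets the induction on
        \<open>q\<close> apply at \<open>j - 1\<close> and makes the ratio logarithmic in
        \<open>n\<close>.\<close>
      then have "2 * j \<le> n" using i by auto
      then have "j - 1 < 2 ^ q" using Suc.prems by simp
      then show "card (rooted_trees (fst i)) \<le> 2 * q * card (rooted_trees (fst i - 1))"
        using Suc.IH[of "j - 1"] i by simp
    qed
    also have "\<dots> = 2 * q * card ?S" using finI by (simp add: card_SigmaI sum_distrib_left)
    also have "card ?S = card ((\<lambda>((j, M), S). Node (add_mset S M)) ` ?S)"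
    proof (rule card_image[symmetric], rule inj_onI)
      fix x y assume "x \<in> ?S" "y \<in> ?S"
        and eq: "(\<lambda>((j, M), S). Node (add_mset S M)) x = (\<lambda>((j, M), S). Node (add_mset S M)) y"
      then obtain j M S j' M' S' where xy: "x = ((j, M), S)" "y = ((j', M'), S')"
        and I: "(j, M) \<in> I" "(j', M') \<in> I"
        and S: "S \<in> rooted_trees (j - 1)" "S' \<in> rooted_trees (j' - 1)" by (cases x; cases y) auto
      have eq: "add_mset S M = add_mset S' M'" using eq xy by simp
      have lt: "\<forall>c\<in>#M. tree_size S < tree_size c" "\<forall>c\<in>#M'. tree_size S' < tree_size c"
        using I S by (auto simp: I_def rooted_trees_def)
      then have "S = S'" using eq by (metis insert_noteq_member less_asym union_single_eq_member)
      then show "x = y"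
        using eq I S xy by (auto simp: I_def rooted_trees_def)
    qed
    also have "\<dots> \<le> card (rooted_trees n)"
      by (rule card_mono[OF finite_rooted_trees]) (auto simp: rooted_trees_def I_def)
    finally show ?thesis by simp
  qed
  finally show ?case by (simp add: algebra_simps)
qed

text \<open>With \<open>q\<close> near the binary logarithm of the size, a bounded increase
  \<open>s\<close> costs only a power of a logarithm.\<close>

lemma card_rooted_trees_add:
  assumes "n \<ge> 1" "n + s \<le> 2 ^ q"
  shows "card (rooted_trees (n + s)) \<le> (2 * q) ^ s * card (rooted_trees n)"
  using assms(2)
proof (induction s)
  case (Suc s)
  have "card (rooted_trees (n + Suc s)) \<le> 2 * q * card (rooted_trees (n + s))"
    using card_rooted_trees_Suc[of "n + s" q] Suc.prems assms(1) by simp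
  also have "\<dots> \<le> 2 * q * ((2 * q) ^ s * card (rooted_trees n))"
    using Suc by (intro mult_left_mono) auto
  finally show ?case by (simp add: algebra_simps)
qed simp

subsection \<open>Trees with few kinds of vertices\<close>

text \<open>The number of orbits of the vertices under the automorphisms of the rooted tree.\<close>
function orbits :: "rtree \<Rightarrow> nat" where
  "orbits (Node M) = Suc (\<Sum>c\<in>set_mset M. orbits c)"
  by (metis rtree.exhaust) simp
termination
  by (relation "measure tree_size") (use tree_size_child in auto)

declare orbits.simps [simp del]

lemma orbits_pos [simp]: "0 < orbits t"
  by (cases t) (simp add: orbits.simps)

lemma orbits_neq_0 [simp]: "orbits t \<noteq> 0"
  using orbits_pos[of t] by linarith

text \<open>Copies of one branch are interchangeable, so together they contribute the orbits of a
  single copy, whatever \<open>p\<close> is.\<close>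

lemma orbits_attach: "c \<notin># M \<Longrightarrow> p > 0 \<Longrightarrow> orbits (Node (M + replicate_mset p c)) = orbits (Node M) + orbits c"
  by (simp add: orbits.simps)

lemma sum_set_mset_le: "(\<Sum>x\<in>set_mset M. f x) \<le> (\<Sum>\<^sub># (image_mset f M) :: nat)"
  by (induction M) (auto simp: sum.insert_if)

lemma orbits_le_size: "orbits t \<le> tree_size t"
proof (induction t)
  case (Node M)
  have "(\<Sum>c\<in>set_mset M. orbits c) \<le> (\<Sum>c\<in>set_mset M. tree_size c)"
    using Node by (intro sum_mono) auto
  also have "\<dots> \<le> \<Sum>\<^sub># (image_mset tree_size M)"
    by (rule sum_set_mset_le)
  finally show ?case by (simp add: orbits.simps)
qed

text \<open>Strip all \<open>p\<close> copies of one branch \<open>c\<close> from the root: the tree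
  is coded by \<open>p\<close>, \<open>c\<close> and the rest, and the orbits split as
  \<open>j\<close> and \<open>i - j\<close>. There are at most \<open>N\<close> choices of
  \<open>p\<close>, so induction gives at most \<open>N ^ (2 * i - 3)\<close> trees for each
  \<open>j\<close>, and \<open>j\<close> takes fewer than \<open>N\<close> values. For
  \<open>i > N\<close> there is no such tree.\<close>

lemma card_few_orbits:
  "i \<ge> 1 \<Longrightarrow> card {t. tree_size t \<le> N \<and> orbits t = i} \<le> N ^ (2 * (i - 1))"
proof (induction i rule: less_induct)
  case (less i)
  let ?F = "\<lambda>j. {t. tree_size t \<le> N \<and> orbits t = j}"
  have fin: "finite (?F j)" for j
    by (rule finite_subset[OF _ finite_size_le[of N]]) auto
  consider "i = 1" | "i > N" | "2 \<le> i" "i \<le> N" using less.prems by linarith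
  then show ?case
  proof cases
    case 1
    have "?F i \<subseteq> {Node {#}}"
    proof
      fix t assume "t \<in> ?F i"
      then show "t \<in> {Node {#}}" using 1 
        by (cases t rule: rtree_attach_cases) (auto simp: orbits.simps)
    qed
    then have "card (?F i) \<le> card {Node {#}}" by (intro card_mono) auto
    then show ?thesis using 1 by simp
  next
    case 2
    have "orbits t \<noteq> i" if "tree_size t \<le> N" for t
      using orbits_le_size[of t] that 2 by linarith
    then have "?F i = {}" by blast
    then show ?thesis by (metis card.empty le0)
  next
    case 3
    define D where "D j = (\<lambda>(p, c, t). Node (children t + replicate_mset p c)) `
       ({1..N} \<times> ?F j \<times> ?F (i - j))" for j
    have finD: "finite (D j)" for j using fin by (simp add: D_def)
    have cardD: "card (D j) \<le> N ^ (2 * i - 3)" if "j \<in> {1..<i}" for j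
    proof -
      have "card (D j) \<le> card ({1..N} \<times> ?F j \<times> ?F (i - j))"
        unfolding D_def using fin by (intro card_image_le) auto
      also have "\<dots> = N * (card (?F j) * card (?F (i - j)))" by (simp add: card_cartesian_product)
      also have "\<dots> \<le> N * (N ^ (2 * (j - 1)) * N ^ (2 * (i - j - 1)))"
        using less.IH[of j] less.IH[of "i - j"] that by (intro mult_left_mono mult_mono) auto
      also have "\<dots> = N ^ Suc (2 * (j - 1) + 2 * (i - j - 1))" by (simp add: power_add)
      also have "Suc (2 * (j - 1) + 2 * (i - j - 1)) = 2 * i - 3" using that by auto
      finally show ?thesis .
    qed
    have "?F i \<subseteq> (\<Union>j\<in>{1..<i}. D j)"
    proof
      fix t assume t: "t \<in> ?F i"
      obtain M where M: "t = Node M" by (cases t)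
      have "M \<noteq> {#}" using t M 3 by (auto simp: orbits.simps)
      then obtain c where c: "c \<in># M" by blast
      define p where "p = count M c"
      define M' where "M' = filter_mset (\<lambda>x. x \<noteq> c) M"
      have MM': "M = M' + replicate_mset p c"
        by (auto simp: M'_def p_def multiset_eq_iff)
      have p: "p > 0" using c by (simp add: p_def)
      have orb: "orbits t = orbits (Node M') + orbits c"
        unfolding M MM' by (rule orbits_attach) (use p in \<open>auto simp: M'_def\<close>)
      have sz: "tree_size t = tree_size (Node M') + p * tree_size c"
        unfolding M MM' by simp
      have "p * 1 \<le> p * tree_size c" by (intro mult_left_mono) (auto simp: Suc_le_eq)
      then have pN: "p \<le> N" using sz t unfolding mult_1_right mem_Collect_eq by linarith
      have "1 * tree_size c \<le> p * tree_size c" using p by (intro mult_right_mono) auto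
      then have "tree_size c \<le> N" "tree_size (Node M') \<le> N"
        using sz t unfolding mult_1 mem_Collect_eq by linarith+
      then have "t \<in> D (orbits c)"
        unfolding D_def using t p pN orb M MM'
        by (intro image_eqI[of _ _ "(p, c, Node M')"]) auto
      moreover have "orbits c \<in> {1..<i}" using orb t orbits_pos[of c] orbits_pos[of "Node M'"] 
        by (auto simp: Suc_le_eq simp del: orbits_pos)
      ultimately show "t \<in> (\<Union>j\<in>{1..<i}. D j)" by blast
    qed
    then have "card (?F i) \<le> card (\<Union>j\<in>{1..<i}. D j)" using finD by (intro card_mono) auto
    also have "\<dots> \<le> (\<Sum>j\<in>{1..<i}. card (D j))" by (rule card_UN_le) simp
    also have "\<dots> \<le> (\<Sum>j\<in>{1..<i}. N ^ (2 * i - 3))" using cardD by (rule sum_mono)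
    also have "\<dots> \<le> N * N ^ (2 * i - 3)" using 3 by simp
    also have "\<dots> = N ^ Suc (2 * i - 3)" by simp
    also have "Suc (2 * i - 3) = 2 * (i - 1)" using 3 by simp
    finally show ?thesis .
  qed
qed

lemma card_few_orbits_le:
  assumes "N \<ge> 1"
  shows "card {t \<in> rooted_trees N. orbits t < m} \<le> m * N ^ (2 * m)"
proof -
  let ?F = "\<lambda>j. {t. tree_size t \<le> N \<and> orbits t = j}"
  have fin: "finite (?F j)" for j
    by (rule finite_subset[OF _ finite_size_le[of N]]) auto
  have "{t \<in> rooted_trees N. orbits t < m} \<subseteq> (\<Union>j\<in>{1..<m}. ?F j)"
    by (auto simp: rooted_trees_def Suc_le_eq)
  then have "card {t \<in> rooted_trees N. orbits t < m} \<le> card (\<Union>j\<in>{1..<m}. ?F j)"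
    using fin by (intro card_mono) auto
  also have "\<dots> \<le> (\<Sum>j\<in>{1..<m}. card (?F j))" by (rule card_UN_le) simp
  also have "\<dots> \<le> (\<Sum>j\<in>{1..<m}. N ^ (2 * m))"
  proof (rule sum_mono)
    fix j assume j: "j \<in> {1..<m}"
    have "card (?F j) \<le> N ^ (2 * (j - 1))" using j by (intro card_few_orbits) auto
    also have "\<dots> \<le> N ^ (2 * m)" using assms j by (intro power_increasing) auto
    finally show "card (?F j) \<le> N ^ (2 * m)" .
  qed
  also have "\<dots> \<le> m * N ^ (2 * m)" by simp
  finally show ?thesis .
qed

subsection \<open>Inserting a branch\<close>

text \<open>The relation does not name the vertex at which \<open>B\<close> is hung: terms have no
  labelled vertices, and vertices in one orbit give the same result.\<close>

inductive inserted :: "rtree \<Rightarrow> rtree \<Rightarrow> rtree \<Rightarrow> bool" for B where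
  here: "inserted B (Node M) (Node (add_mset B M))"
| below: "inserted B c c' \<Longrightarrow> inserted B (Node (add_mset c M)) (Node (add_mset c' M))"

lemma inserted_size: "inserted B t t' \<Longrightarrow> tree_size t' = tree_size t + tree_size B"
  by (induction rule: inserted.induct) auto

lemma inserted_subtree: "inserted B t t' \<Longrightarrow> B \<in> subtrees t'"
  by (induction rule: inserted.induct) auto

lemma inserted_neq: "inserted B t t' \<Longrightarrow> t' \<noteq> B"
  using inserted_size[of B t t'] by auto

text \<open>A subtree created by the insertion either lies in \<open>B\<close>, and is then
  \<open>B\<close> or smaller, or properly contains \<open>B\<close>, and is then larger. So no
  other subtree of the size of \<open>B\<close> arises.\<close>

lemma inserted_avoids:
  assumes "inserted B t t'" "C \<notin> subtrees t" "C \<noteq> B" "tree_size C = tree_size B"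
  shows "C \<notin> subtrees t'"
  using assms
proof (induction rule: inserted.induct)
  case (here M)
  have "C \<notin> subtrees B" using subtrees_size[of C B] here by auto
  moreover have "C \<noteq> Node (add_mset B M)" using here by auto
  ultimately show ?case using here by auto
next
  case (below c c' M)
  have "C \<noteq> Node (add_mset c' M)" using below.prems inserted_size[OF below.hyps] by auto
  then show ?case using below by auto
qed

text \<open>The inserted copy is the only occurrence of \<open>B\<close> in \<open>u\<close>, so
  removing it recovers the original tree.\<close>

lemma inserted_inj:
  assumes "inserted B t u" "inserted B t' u" "B \<notin> subtrees t" "B \<notin> subtrees t'"
  shows "t = t'"
  using assms
proof (induction arbitrary: t' rule: inserted.induct)
  case (here M)
  from here.prems(1) show ?case
  proof cases
    case (below c c' M')
    then have "B \<in># add_mset c' M'" by (metis union_single_eq_member)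
    then have "B \<in># M'" using inserted_neq[OF \<open>inserted B c c'\<close>] by auto
    then have "B \<in> subtrees t'" using below by force
    then show ?thesis using here by simp
  qed simp
next
  case (below c c' M)
  from below.prems(1) show ?case
  proof cases
    case (here M')
    then have "B \<in># add_mset c' M" by auto
    then have "B \<in># M" using inserted_neq[OF below.hyps] by auto
    then have "B \<in> subtrees (Node (add_mset c M))" by force
    then show ?thesis using below.prems by simp
  next
    case (below d d' M')
    \<comment> \<open>Exactly one child of the root of \<open>u\<close> contains \<open>B\<close>.
      Filtering for it on both sides identifies the child that was changed.\<close>
    have "filter_mset (\<lambda>x. B \<in> subtrees x) M = {#}" "filter_mset (\<lambda>x. B \<in> subtrees x) M' = {#}"
      using below below.prems by (auto simp: filter_mset_eq_mempty_iff)
    moreover have "B \<in> subtrees c'" "B \<in> subtrees d'"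
      using below.hyps \<open>inserted B d d'\<close> inserted_subtree by auto
    ultimately have "c' = d'"
      using arg_cong[OF \<open>add_mset c' M = add_mset d' M'\<close>, of "filter_mset (\<lambda>x. B \<in> subtrees x)"]
      by (simp del: filter_mset_eq_mempty_iff)
    then show ?thesis using below below.prems below.IH[of d] by auto
  qed
qed

lemma finite_inserted: "finite {u. inserted B t u}"
  by (rule finite_subset[OF _ finite_size_le[of "tree_size t + tree_size B"]])
    (auto dest: inserted_size)

text \<open>Hanging \<open>B\<close> at vertices of different orbits gives different trees.
  Inductively, the results of insertion at the root and inside the distinct children form disjoint
  families: the only child containing \<open>B\<close> shows what was changed, and it equals
  \<open>B\<close> only for insertion at the root.\<close>

lemma card_inserted: "B \<notin> subtrees t \<Longrightarrow> orbits t \<le> card {u. inserted B t u}"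
proof (induction t)
  case (Node M)
  define D where "D c = (\<lambda>c'. Node (add_mset c' (M - {#c#}))) ` {u. inserted B c u}" for c
  have avoid: "B \<notin> subtrees c" if "c \<in># M" for c using Node.prems that by auto
  have filt: "filter_mset (\<lambda>x. B \<in> subtrees x) (M - {#c#}) = {#}" for c
    unfolding filter_mset_eq_mempty_iff using avoid by (auto dest: in_diffD)
  have filtD: "filter_mset (\<lambda>x. B \<in> subtrees x) (add_mset c' (M - {#c#})) = {#c'#}"
    if "inserted B c c'" for c c'
    using filt[of c] inserted_subtree[OF that] by simp
  have finD: "finite (D c)" for c unfolding D_def using finite_inserted by simp
  have cardD: "card (D c) = card {u. inserted B c u}" for c
    unfolding D_def by (rule card_image) (auto intro: inj_onI)
  have disj: "D c \<inter> D d = {}" if "c \<in># M" "d \<in># M" "c \<noteq> d" for c d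
  proof (rule ccontr)
    assume "D c \<inter> D d \<noteq> {}"
    then obtain c' d' where *: "inserted B c c'" "inserted B d d'"
      "add_mset c' (M - {#c#}) = add_mset d' (M - {#d#})" unfolding D_def by auto
    have "{#c'#} = {#d'#}" using filtD[OF *(1)] filtD[OF *(2)] *(3) by metis
    then have "M - {#c#} = M - {#d#}" using * by simp
    then have "add_mset c (M - {#c#}) = add_mset d (M - {#c#})" using that by (metis insert_DiffM)
    from arg_cong[OF this, of "\<lambda>A. count A c"] have "count M c = count M c - 1"
      using that by (simp del: insert_DiffM)
    moreover have "count M c > 0" using that by simp
    ultimately show False by linarith
  qed
  have notin: "Node (add_mset B M) \<notin> (\<Union>c\<in>set_mset M. D c)"
  proof
    assume "Node (add_mset B M) \<in> (\<Union>c\<in>set_mset M. D c)"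
    then obtain c c' where *: "inserted B c c'" "add_mset B M = add_mset c' (M - {#c#})"
      by (auto simp: D_def)
    have "filter_mset (\<lambda>x. B \<in> subtrees x) (add_mset B M) = {#B#}"
      using avoid by (auto simp: filter_mset_eq_mempty_iff)
    then have "B = c'" using filtD[OF *(1)] *(2) by simp
    then show False using inserted_neq[OF *(1)] by simp
  qed
  have "orbits (Node M) = Suc (\<Sum>c\<in>set_mset M. orbits c)" by (simp add: orbits.simps)
  also have "\<dots> \<le> Suc (\<Sum>c\<in>set_mset M. card (D c))"
    unfolding cardD using Node.IH avoid by (auto intro: sum_mono)
  also have "\<dots> = card (insert (Node (add_mset B M)) (\<Union>c\<in>set_mset M. D c))"
    using notin finD disj by (simp add: card_UN_disjoint)
  also have "\<dots> \<le> card {u. inserted B (Node M) u}"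
  proof (rule card_mono[OF finite_inserted], safe)
    show "inserted B (Node M) (Node (add_mset B M))" by (rule inserted.here)
  next
    fix c u assume "c \<in># M" "u \<in> D c"
    then obtain c' where "u = Node (add_mset c' (M - {#c#}))" "inserted B c c'" by (auto simp: D_def)
    then show "inserted B (Node M) u"
      using inserted.below[of B c c' "M - {#c#}"] \<open>c \<in># M\<close> by simp
  qed
  finally show ?case .
qed

text \<open>A tree with at least \<open>m\<close> orbits has at least \<open>m\<close> results by
  \<open>card_inserted\<close>, and different trees share none by \<open>inserted_inj\<close>. The
  remaining trees are few by \<open>card_few_orbits_le\<close>.\<close>

lemma card_avoiding_le:
  assumes X: "X \<subseteq> rooted_trees N" "\<And>t. t \<in> X \<Longrightarrow> B \<notin> subtrees t" and "N \<ge> 1"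
  shows "m * card X \<le> card (\<Union>t\<in>X. {u. inserted B t u}) + m * (m * N ^ (2 * m))"
proof -
  define Y where "Y = {t \<in> X. m \<le> orbits t}"
  have finX: "finite X" using X finite_subset finite_rooted_trees by blast
  have finY: "finite Y" using finX by (simp add: Y_def)
  have "card X \<le> card (Y \<union> {t \<in> rooted_trees N. orbits t < m})"
    using X finY by (intro card_mono) (auto simp: Y_def)
  also have "\<dots> \<le> card Y + card {t \<in> rooted_trees N. orbits t < m}" by (rule card_Un_le)
  also have "\<dots> \<le> card Y + m * N ^ (2 * m)" using card_few_orbits_le[OF \<open>N \<ge> 1\<close>] by simp
  finally have "m * card X \<le> m * card Y + m * (m * N ^ (2 * m))"
    by (metis add_mult_distrib2 mult_le_mono2)
  also have "m * card Y \<le> card (\<Union>t\<in>Y. {u. inserted B t u})"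
  proof -
    have "m * card Y = (\<Sum>t\<in>Y. m)" by simp
    also have "\<dots> \<le> (\<Sum>t\<in>Y. card {u. inserted B t u})"
      using X(2) card_inserted by (intro sum_mono) (force simp: Y_def intro: order_trans)
    also have "\<dots> = card (\<Union>t\<in>Y. {u. inserted B t u})"
    proof (rule card_UN_disjoint[symmetric])
      show "\<forall>t\<in>Y. \<forall>t'\<in>Y. t \<noteq> t' \<longrightarrow> {u. inserted B t u} \<inter> {u. inserted B t' u} = {}"
        using X(2) inserted_inj by (fastforce simp: Y_def)
    qed (use finY finite_inserted in auto)
    finally show ?thesis .
  qed
  also have "card (\<Union>t\<in>Y. {u. inserted B t u}) \<le> card (\<Union>t\<in>X. {u. inserted B t u})"
    using finX finite_inserted by (intro card_mono) (auto simp: Y_def)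
  finally show ?thesis by simp
qed

text \<open>
  Inserting the two branches one after the other gains the number of orbits twice; one factor alone
  would not outweigh the factor \<open>n\<close> lost between rooted and unrooted trees.
\<close>
lemma card_avoiding_le2:
  fixes L :: rtree and n m q :: nat
  defines "b \<equiv> tree_size L + 2"
  assumes "n \<ge> 1" "n + 2 * b \<le> 2 ^ q"
  shows "m * (m * card {t \<in> rooted_trees n. L \<notin> subtrees t})
    \<le> (2 * q) ^ (2 * b) * card (rooted_trees n) + 2 * (m * (m * (m * (n + b) ^ (2 * m))))"
proof -
  \<comment> \<open>Two different branches of equal size, both containing \<open>L\<close>: trees
    avoiding \<open>L\<close> avoid both, and inserting \<open>B1\<close> cannot create
    \<open>B2\<close> by \<open>inserted_avoids\<close>.\<close>
  define B1 where "B1 = Node {#Node {#L#}#}"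
  define B2 where "B2 = Node {#L, Node {#}#}"
  have size: "tree_size B1 = b" "tree_size B2 = b" by (simp_all add: B1_def B2_def b_def)
  have "B1 \<noteq> B2" by (simp add: B1_def B2_def)
  have L: "L \<in> subtrees B1" "L \<in> subtrees B2" by (simp_all add: B1_def B2_def)
  define X where "X = {t \<in> rooted_trees n. L \<notin> subtrees t}"
  define Y where "Y = (\<Union>t\<in>X. {u. inserted B1 t u})"
  define Z where "Z = (\<Union>t\<in>Y. {u. inserted B2 t u})"
  have av: "B1 \<notin> subtrees t" "B2 \<notin> subtrees t" if "t \<in> X" for t
    using that L subtrees_trans by (auto simp: X_def)
  have Y: "Y \<subseteq> rooted_trees (n + b)" "\<And>t. t \<in> Y \<Longrightarrow> B2 \<notin> subtrees t"
    using inserted_size inserted_avoids[of B1 _ _ B2] av size \<open>B1 \<noteq> B2\<close>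
    by (force simp: Y_def X_def rooted_trees_def)+
  have "Z \<subseteq> rooted_trees (n + 2 * b)"
    using Y inserted_size size by (force simp: Z_def rooted_trees_def)
  then have "card Z \<le> card (rooted_trees (n + 2 * b))" by (intro card_mono) auto
  also have "\<dots> \<le> (2 * q) ^ (2 * b) * card (rooted_trees n)"
    using assms by (intro card_rooted_trees_add) auto
  finally have Z: "card Z \<le> (2 * q) ^ (2 * b) * card (rooted_trees n)" .
  have "m * card X \<le> card Y + m * (m * n ^ (2 * m))"
    unfolding Y_def by (rule card_avoiding_le) (use assms av in \<open>auto simp: X_def\<close>)
  also have "\<dots> \<le> card Y + m * (m * (n + b) ^ (2 * m))"
    by (intro add_left_mono mult_left_mono power_mono) auto
  finally have "m * (m * card X) \<le> m * (card Y + m * (m * (n + b) ^ (2 * m)))"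
    by (rule mult_le_mono2)
  moreover have "m * card Y \<le> card Z + m * (m * (n + b) ^ (2 * m))"
    unfolding Z_def by (rule card_avoiding_le) (use assms Y in auto)
  moreover have "m * (m * (n + b) ^ (2 * m)) \<le> m * (m * (m * (n + b) ^ (2 * m)))"
    by (cases m) simp_all
  ultimately show ?thesis using Z unfolding X_def[symmetric] distrib_left by linarith
qed

text \<open>Take \<open>m\<close> near n^(3/4). Then m^2 beats n times any power of log n, while
  n^(2m) stays subexponential; any exponent strictly between 1/2 and 1 would serve. The factor
  \<open>real n\<close> prepares the passage from rooted to unrooted trees.\<close>

proposition avoiding_negligible:
  "(\<lambda>n. real n * real (card {t \<in> rooted_trees n. L \<notin> subtrees t}) / real (card (rooted_trees n)))
     \<longlonglongrightarrow> 0"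
proof -
  define b where "b = tree_size L + 2"
  define a where "a n = card {t \<in> rooted_trees n. L \<notin> subtrees t}" for n
  define t where "t n = card (rooted_trees n)" for n
  \<comment> \<open>\<open>f\<close> and \<open>g\<close> bound the main term and the error term of
    \<open>card_avoiding_le2\<close>, multiplied by \<open>n\<close> and divided by m^2 and the
    number of rooted trees. The added 1 and 2 absorb the rounding of \<open>m\<close> and
    \<open>q\<close>, the exponent \<open>real n / 2 - 1\<close> that of
    \<open>card_rooted_trees_ge\<close>.\<close>
  define f where "f n = real n * (2 * (log 2 (real n + 2 * real b) + 1)) ^ (2 * b) / (real n powr (3/4))\<^sup>2" for n
  define g where "g n = 2 * real n * (real n powr (3/4) + 1) * (real n + real b) powr (2 * real n powr (3/4) + 2)
     / 2 powr (real n / 2 - 1)" for n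
  have b: "b \<ge> 2" by (simp add: b_def)
  have "f \<longlonglongrightarrow> 0" unfolding f_def by real_asymp
  moreover have "g \<longlonglongrightarrow> 0" unfolding g_def by real_asymp
  ultimately have "(\<lambda>n. f n + g n) \<longlonglongrightarrow> 0" by (auto intro: tendsto_eq_intros)
  moreover have "norm (real n * real (a n) / real (t n)) \<le> f n + g n" if n: "n \<ge> 1" for n
  proof -
    define m where "m = nat \<lceil>real n powr (3/4)\<rceil>"
    define q where "q = nat \<lceil>log 2 (real n + 2 * real b)\<rceil>"
    have m: "real n powr (3/4) \<le> real m" "real m \<le> real n powr (3/4) + 1"
      unfolding m_def by (simp_all add: real_nat_ceiling_ge of_nat_nat le_of_int_ceiling; linarith)+
    have np: "real n powr (3/4) > 0" using n by simp
    then have m0: "real m > 0" using m by linarith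
    have lg: "log 2 (real n + 2 * real b) \<ge> 0" using n b by simp
    have q: "log 2 (real n + 2 * real b) \<le> real q" "real q \<le> log 2 (real n + 2 * real b) + 1"
      unfolding q_def using lg by linarith+
    have "real (n + 2 * b) = 2 powr log 2 (real n + 2 * real b)" using n by simp
    also have "\<dots> \<le> 2 powr real q" using q by (intro powr_mono) auto
    also have "\<dots> = real (2 ^ q)" by (simp add: powr_realpow)
    finally have "n + 2 * b \<le> 2 ^ q" by (simp only: of_nat_le_iff)
    from card_avoiding_le2[OF n this[unfolded b_def], of m]
    have "real (m * (m * a n)) \<le> real ((2 * q) ^ (2 * b) * t n + 2 * (m * (m * (m * (n + b) ^ (2 * m)))))"
      unfolding a_def t_def b_def of_nat_le_iff .
    then have main: "real m ^ 2 * real (a n)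
      \<le> (2 * real q) ^ (2 * b) * real (t n) + real m ^ 2 * (2 * real m * real (n + b) ^ (2 * m))"
      by (simp add: power2_eq_square algebra_simps)
    have t0: "real (t n) > 0" unfolding t_def using card_rooted_trees_pos[OF n] by simp
    have "real (a n) / real (t n) \<le> (2 * real q) ^ (2 * b) / real m ^ 2
        + 2 * real m * real (n + b) ^ (2 * m) / real (t n)"
      using main t0 m0 by (simp add: field_simps)
    then have "real n * (real (a n) / real (t n)) \<le> real n * ((2 * real q) ^ (2 * b) / real m ^ 2
        + 2 * real m * real (n + b) ^ (2 * m) / real (t n))"
      by (rule mult_left_mono) simp
    also have "\<dots> = real n * (2 * real q) ^ (2 * b) / real m ^ 2
        + 2 * real n * real m * real (n + b) ^ (2 * m) / real (t n)" by (simp add: algebra_simps)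
    also have "\<dots> \<le> f n + g n"
    proof (rule add_mono)
      show "real n * (2 * real q) ^ (2 * b) / (real m)\<^sup>2 \<le> f n"
        unfolding f_def using q np m
        by (intro frac_le mult_left_mono power_mono mult_nonneg_nonneg zero_le_power) auto
      have "2 powr (real n / 2 - 1) \<le> 2 powr real ((n - 1) div 2)"
        by (intro powr_mono) linarith+
      also have "\<dots> = real (2 ^ ((n - 1) div 2))" by (simp add: powr_realpow)
      also have "\<dots> \<le> real (t n)" unfolding t_def of_nat_le_iff by (rule card_rooted_trees_ge[OF n])
      finally have t: "2 powr (real n / 2 - 1) \<le> real (t n)" .
      have "real (n + b) ^ (2 * m) = (real n + real b) powr real (2 * m)"
        using n by (subst powr_realpow) auto
      also have "\<dots> \<le> (real n + real b) powr (2 * real n powr (3/4) + 2)"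
        using n m by (intro powr_mono) auto
      finally have "real (n + b) ^ (2 * m) \<le> (real n + real b) powr (2 * real n powr (3/4) + 2)" .
      then show "2 * real n * real m * real (n + b) ^ (2 * m) / real (t n) \<le> g n"
        unfolding g_def using t m np
        by (intro frac_le mult_mono mult_nonneg_nonneg) auto
    qed
    finally show ?thesis by simp
  qed
  then have "eventually (\<lambda>n. norm (real n * real (a n) / real (t n)) \<le> norm (f n + g n) * 1) sequentially"
    unfolding eventually_sequentially by (metis abs_ge_self mult_1_right order_trans real_norm_def)
  ultimately show ?thesis
    unfolding a_def t_def by (rule tendsto_0_le)
qed

subsection \<open>Characteristic polynomials over vertex sets\<close>

text \<open>The Leibniz formula over an arbitrary index set, so that passing to a subset of the
  vertices needs no reindexing.\<close>

definition set_det :: "('a \<Rightarrow> 'a \<Rightarrow> 'b::comm_ring_1) \<Rightarrow> 'a set \<Rightarrow> 'b" where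
  "set_det M V = (\<Sum>p | p permutes V. of_int (sign p) * (\<Prod>v\<in>V. M v (p v)))"

text \<open>A permutation of the union that maps \<open>V\<close> into itself is the composition of
  a permutation of \<open>V\<close> and one of \<open>W\<close>, and both the sign and the product
  of entries factor.\<close>

lemma set_det_preserving:
  assumes fin: "finite V" "finite W" and disj: "V \<inter> W = {}"
  shows "(\<Sum>p | p permutes V \<union> W \<and> p ` V \<subseteq> V. of_int (sign p) * (\<Prod>v\<in>V \<union> W. M v (p v))) =
    set_det M V * set_det M W" (is "sum ?f ?S = _")
proof -
  have "set_det M V * set_det M W = (\<Sum>(p, q)\<in>{p. p permutes V} \<times> {q. q permutes W}.
     (of_int (sign p) * (\<Prod>v\<in>V. M v (p v))) * (of_int (sign q) * (\<Prod>v\<in>W. M v (q v))))"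
    unfolding set_det_def sum_product sum.cartesian_product by simp
  also have "\<dots> = sum ?f ?S"
  proof (rule sum.reindex_bij_witness[of _ "\<lambda>p. (restrict_id p V, restrict_id p W)" "\<lambda>(p, q). p \<circ> q"], goal_cases)
    case (1 a)
    then obtain p q where a: "a = (p, q)" and p: "p permutes V" and q: "q permutes W" by (cases a) auto
    have "(p \<circ> q) x = p x" if "x \<in> V" for x
    proof -
      have "x \<notin> W" using that disj by auto
      then show ?thesis using permutes_not_in[OF q] by simp
    qed
    moreover have "(p \<circ> q) x = q x" if "x \<in> W" for x
    proof -
      have "q x \<in> W" using q that by (simp add: permutes_in_image)
      then have "q x \<notin> V" using disj by auto
      then show ?thesis using permutes_not_in[OF p] by auto
    qed
    ultimately show ?case using permutes_not_in[OF p] permutes_not_in[OF q] a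
      by (auto simp: restrict_id_def fun_eq_iff)
  next
    case (2 a)
    then obtain p q where a: "a = (p, q)" and p: "p permutes V" and q: "q permutes W" by (cases a) auto
    have "p permutes V \<union> W" "q permutes V \<union> W"
      using p q by (auto intro: permutes_subset)
    then have "p \<circ> q permutes V \<union> W" by (rule permutes_compose[rotated])
    moreover have "(p \<circ> q) x \<in> V" if "x \<in> V" for x
    proof -
      have "q x = x" using that disj permutes_not_in[OF q] by auto
      then show ?thesis using p that by (simp add: permutes_in_image)
    qed
    ultimately show ?case using a by auto
  next
    case (3 p)
    then have p: "p permutes V \<union> W" and V: "p ` V \<subseteq> V" by auto
    have pV: "p ` V = V" using V fin p by (metis endo_inj_surj inj_on_subset permutes_inj subset_UNIV)
    have pW: "p x \<in> W" if "x \<in> W" for x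
    proof -
      have "p x \<in> V \<union> W" using p that by (metis UnI2 permutes_in_image)
      moreover have "p x \<notin> V"
      proof
        assume "p x \<in> V"
        then obtain y where "y \<in> V" "p y = p x" using pV by (metis imageE)
        then have "y = x" using permutes_inj[OF p] by (simp add: inj_eq)
        then show False using \<open>y \<in> V\<close> that disj by auto
      qed
      ultimately show ?thesis by simp
    qed
    show ?case
    proof
      fix x
      show "(case (restrict_id p V, restrict_id p W) of (p, q) \<Rightarrow> p \<circ> q) x = p x"
        using pW[of x] disj permutes_not_in[OF p, of x] by (auto simp: restrict_id_def)
    qed
  next
    case (4 p)
    then have p: "p permutes V \<union> W" and V: "p ` V \<subseteq> V" by auto
    have pV: "p ` V = V" using V fin p by (metis endo_inj_surj inj_on_subset permutes_inj subset_UNIV)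
    have "p ` W = W"
    proof -
      have "p ` V \<union> p ` W = V \<union> W" using permutes_image[OF p] by (simp add: image_Un)
      moreover have "p ` V \<inter> p ` W = {}"
        using disj permutes_inj[OF p] by (metis image_Int image_empty)
      moreover have "B = W" if "V \<union> B = V \<union> W" "V \<inter> B = {}" for B
        using that disj by blast
      ultimately show ?thesis unfolding pV by blast
    qed
    then have "bij_betw p V V" "bij_betw p W W"
      using pV inj_on_subset[OF permutes_inj[OF p] subset_UNIV] by (simp_all add: bij_betw_def)
    then have "restrict_id p V permutes V" "restrict_id p W permutes W"
      by (simp_all only: permutes_restrict_id)
    then show ?case by (intro SigmaI CollectI)
  next
    case (5 a)
    then obtain p q where a: "a = (p, q)" and p: "p permutes V" and q: "q permutes W" by (cases a) auto
    have "permutation p" "permutation q" using p q fin by (auto simp: permutation_permutes)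
    then have s: "sign (p \<circ> q) = sign p * sign q" by (rule sign_compose)
    have "(\<Prod>v\<in>V \<union> W. M v ((p \<circ> q) v)) = (\<Prod>v\<in>V. M v ((p \<circ> q) v)) * (\<Prod>v\<in>W. M v ((p \<circ> q) v))"
      by (rule prod.union_disjoint) (use assms in auto)
    also have "(\<Prod>v\<in>V. M v ((p \<circ> q) v)) = (\<Prod>v\<in>V. M v (p v))"
    proof (rule prod.cong)
      fix v assume "v \<in> V"
      then have "v \<notin> W" using disj by auto
      then show "M v ((p \<circ> q) v) = M v (p v)" using permutes_not_in[OF q] by simp
    qed simp
    also have "(\<Prod>v\<in>W. M v ((p \<circ> q) v)) = (\<Prod>v\<in>W. M v (q v))"
    proof (rule prod.cong)
      fix v assume "v \<in> W"
      then have "q v \<notin> V" using q disj by (metis disjoint_iff permutes_in_image)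
      then show "M v ((p \<circ> q) v) = M v (q v)" using permutes_not_in[OF p] by simp
    qed simp
    finally show ?case using a s by simp
  qed
  finally show ?thesis ..
qed

text \<open>A permutation taking some element of \<open>V\<close> into \<open>W\<close> meets a zero
  entry, so only those preserving \<open>V\<close> survive.\<close>

lemma set_det_block:
  assumes fin: "finite V" "finite W" and disj: "V \<inter> W = {}"
    and zero: "\<And>v w. v \<in> V \<Longrightarrow> w \<in> W \<Longrightarrow> M v w = 0"
  shows "set_det M (V \<union> W) = set_det M V * set_det M W"
proof -
  have "set_det M (V \<union> W)
    = (\<Sum>p | p permutes V \<union> W \<and> p ` V \<subseteq> V. of_int (sign p) * (\<Prod>v\<in>V \<union> W. M v (p v)))"
    unfolding set_det_def
  proof (rule sum.mono_neutral_right)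
    show "\<forall>p\<in>{p. p permutes V \<union> W} - {p. p permutes V \<union> W \<and> p ` V \<subseteq> V}.
       of_int (sign p) * (\<Prod>v\<in>V \<union> W. M v (p v)) = 0"
    proof
      fix p assume "p \<in> {p. p permutes V \<union> W} - {p. p permutes V \<union> W \<and> p ` V \<subseteq> V}"
      then obtain v where v: "p permutes V \<union> W" "v \<in> V" "p v \<notin> V" by auto
      then have "p v \<in> W" by (metis Un_iff permutes_in_image)
      then have "M v (p v) = 0" using v zero by simp
      then have "(\<Prod>v\<in>V \<union> W. M v (p v)) = 0" using v fin by (intro prod_zero) auto
      then show "of_int (sign p) * (\<Prod>v\<in>V \<union> W. M v (p v)) = 0" by simp
    qed
  qed (use fin in \<open>auto intro: finite_permutations\<close>)
  then show ?thesis using set_det_preserving[OF fin disj] by simp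
qed

text \<open>The determinant form of the expansion at a bridge. A permutation with nonzero product
  either preserves \<open>V\<close> or swaps \<open>r\<close> and \<open>c\<close>; the first kind
  gives the product of the two determinants, the second the subtracted term.\<close>

lemma set_det_bridge:
  assumes fin: "finite V" "finite W" and disj: "V \<inter> W = {}" and r: "r \<in> V" and c: "c \<in> W"
    and zero: "\<And>v w. v \<in> V \<Longrightarrow> w \<in> W \<Longrightarrow> \<not> (v = r \<and> w = c) \<Longrightarrow> M v w = 0 \<and> M w v = 0"
    and one: "M r c * M c r = 1"
  shows "set_det M (V \<union> W) = set_det M V * set_det M W - set_det M (V - {r}) * set_det M (W - {c})"
proof -
  let ?U = "V \<union> W" let ?U' = "(V - {r}) \<union> (W - {c})"
  let ?f = "\<lambda>p. of_int (sign p) * (\<Prod>v\<in>?U. M v (p v))"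
  let ?S1 = "{p. p permutes ?U \<and> p ` V \<subseteq> V}" and ?S2 = "{p. p permutes ?U \<and> p r = c \<and> p c = r}"
  have rc: "r \<noteq> c" using r c disj by auto
  have "set_det M ?U = sum ?f (?S1 \<union> ?S2)"
    unfolding set_det_def
  proof (rule sum.mono_neutral_right)
    show "\<forall>p\<in>{p. p permutes ?U} - (?S1 \<union> ?S2). ?f p = 0"
    proof
      fix p assume "p \<in> {p. p permutes ?U} - (?S1 \<union> ?S2)"
      then obtain v where p: "p permutes ?U" and v: "v \<in> V" "p v \<notin> V" and n2: "\<not> (p r = c \<and> p c = r)" by auto
      have pvW: "p v \<in> W" using p v by (metis Un_iff permutes_in_image)
      \<comment> \<open>On a finite set, a permutation that sends something out of \<open>V\<close>
        also sends something into \<open>V\<close>. Both crossings must use the entries at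
        \<open>r\<close> and \<open>c\<close>, or a factor vanishes.\<close>
      have "\<not> p ` W \<subseteq> W"
      proof
        assume "p ` W \<subseteq> W"
        then have "p ` W = W" using fin p by (metis endo_inj_surj inj_on_subset permutes_inj subset_UNIV)
        then obtain w where "w \<in> W" "p w = p v" using pvW by (metis imageE)
        then have "w = v" using permutes_inj[OF p] by (simp add: inj_eq)
        then show False using \<open>w \<in> W\<close> v disj by auto
      qed
      then obtain w where w: "w \<in> W" "p w \<notin> W" by auto
      then have pwV: "p w \<in> V" using p by (metis Un_iff permutes_in_image)
      have "M v (p v) = 0 \<or> M w (p w) = 0"
        using zero[OF v(1) pvW] zero[OF pwV w(1)] n2 by auto
      then have "\<exists>u\<in>?U. M u (p u) = 0" using v w by auto
      then have "(\<Prod>v\<in>?U. M v (p v)) = 0" using fin by (intro prod_zero) auto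
      then show "?f p = 0" by simp
    qed
  qed (use fin in \<open>auto intro: finite_permutations\<close>)
  also have "\<dots> = sum ?f ?S1 + sum ?f ?S2"
    by (rule sum.union_disjoint) (use fin r c disj in \<open>auto intro: finite_subset[OF _ finite_permutations[of ?U]]\<close>)
  also have "sum ?f ?S1 = set_det M V * set_det M W" by (rule set_det_preserving[OF fin disj])
  also have "sum ?f ?S2 = - set_det M ?U'"
  proof -
    \<comment> \<open>Composing with the transposition turns a permutation that swaps
      \<open>r\<close> and \<open>c\<close> into one fixing both. The sign flips, and the two lost
      factors multiply to 1 by \<open>one\<close>.\<close>
    let ?t = "transpose r c"
    have "sum ?f ?S2 = (\<Sum>p | p permutes ?U'. - (of_int (sign p) * (\<Prod>v\<in>?U'. M v (p v))))"
    proof (rule sum.reindex_bij_witness[of _ "\<lambda>p. p \<circ> ?t" "\<lambda>p. p \<circ> ?t"], goal_cases)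
      case (2 p)
      then have p: "p permutes ?U" "p r = c" "p c = r" by auto
      have "p \<circ> ?t permutes ?U"
        using r c p(1) by (intro permutes_compose permutes_swap_id) auto
      moreover have "(p \<circ> ?t) x = x" if "x \<in> ?U - ?U'" for x
        using that p by (auto simp: transpose_def)
      ultimately have "p \<circ> ?t permutes ?U'" by (rule permutes_superset)
      then show ?case by simp
    next
      case (4 p)
      then have p: "p permutes ?U'" by auto
      then have "p permutes ?U" by (rule permutes_subset) auto
      then have "p \<circ> ?t permutes ?U"
        using r c by (intro permutes_compose permutes_swap_id) auto
      moreover have "p r = r" "p c = c" using permutes_not_in[OF p] r c disj by auto
      ultimately show ?case by (auto simp: transpose_def)
    next
      case (5 p)
      then have p: "p permutes ?U" "p r = c" "p c = r" by auto
      have "permutation p" using p fin by (auto simp: permutation_permutes)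
      then have "sign (p \<circ> ?t) = sign p * sign ?t" by (rule sign_compose) (rule permutation_swap_id)
      then have s: "sign (p \<circ> ?t) = - sign p" using rc by (simp add: sign_swap_id)
      have U: "?U = insert r (insert c ?U')" using r c by auto
      have "(\<Prod>v\<in>?U. M v (p v)) = M r c * (M c r * (\<Prod>v\<in>?U'. M v (p v)))"
        unfolding U using rc fin p r c disj by (subst prod.insert; (subst prod.insert)?) auto
      also have "\<dots> = (\<Prod>v\<in>?U'. M v (p v))" using one by (simp flip: mult.assoc)
      also have "\<dots> = (\<Prod>v\<in>?U'. M v ((p \<circ> ?t) v))"
        using r c disj by (intro prod.cong) (auto simp: transpose_def)
      finally show ?case using s by simp
    qed auto
    then show ?thesis unfolding set_det_def by (simp add: sum_negf)
  qed
  also have "set_det M ?U' = set_det M (V - {r}) * set_det M (W - {c})"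
    by (rule set_det_block) (use fin disj zero in auto)
  finally show ?thesis by simp
qed

definition char_entry :: "('a \<Rightarrow> 'a \<Rightarrow> bool) \<Rightarrow> 'a \<Rightarrow> 'a \<Rightarrow> int poly" where
  "char_entry E u v = (if u = v then [:0, 1:] else 0) - (if E u v then 1 else 0)"

text \<open>Keeping the relation and the vertex set apart turns deletion of a vertex into a set
  difference; \<open>graph_char_poly_eq\<close> translates back.\<close>

definition cpoly :: "('a \<Rightarrow> 'a \<Rightarrow> bool) \<Rightarrow> 'a set \<Rightarrow> int poly" where
  "cpoly E = set_det (char_entry E)"

lemma cpoly_union:
  assumes "finite V" "finite W" "V \<inter> W = {}" "\<And>v w. v \<in> V \<Longrightarrow> w \<in> W \<Longrightarrow> \<not> E v w"
  shows "cpoly E (V \<union> W) = cpoly E V * cpoly E W"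
  unfolding cpoly_def by (rule set_det_block) (use assms in \<open>auto simp: char_entry_def\<close>)

lemma cpoly_bridge:
  assumes "finite V" "finite W" "V \<inter> W = {}" "r \<in> V" "c \<in> W"
    and "\<And>v w. v \<in> V \<Longrightarrow> w \<in> W \<Longrightarrow> E v w \<longleftrightarrow> v = r \<and> w = c"
    and "\<And>v w. v \<in> V \<Longrightarrow> w \<in> W \<Longrightarrow> E w v \<longleftrightarrow> v = r \<and> w = c"
  shows "cpoly E (V \<union> W) = cpoly E V * cpoly E W - cpoly E (V - {r}) * cpoly E (W - {c})"
  unfolding cpoly_def by (rule set_det_bridge) (use assms in \<open>auto simp: char_entry_def\<close>)

lemma cpoly_empty: "cpoly E {} = 1"
  by (simp add: cpoly_def set_det_def)

lemma cpoly_singleton: "\<not> E r r \<Longrightarrow> cpoly E {r} = [:0, 1:]"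
  by (simp add: cpoly_def set_det_def char_entry_def)

text \<open>Conjugation by the enumeration matches permutations of indices with permutations of
  \<open>set vs\<close> and preserves signs.\<close>

lemma set_det_eq_det:
  assumes "distinct vs"
  shows "det (mat (length vs) (length vs) (\<lambda>(i, j). M (vs ! i) (vs ! j))) = set_det M (set vs)"
proof -
  define n where "n = length vs"
  let ?I = "{0..<n}" and ?f = "\<lambda>i. vs ! i"
  have bij: "bij_betw ?f ?I (set vs)"
    using bij_betw_nth[OF assms, of ?I] by (simp add: n_def atLeast0LessThan)
  have inj: "inj_on ?f ?I" using bij by (simp add: bij_betw_def)
  let ?g = "inv_into ?I ?f"
  have bij': "bij_betw ?g (set vs) ?I" using bij by (rule bij_betw_inv_into)
  have "det (mat n n (\<lambda>(i, j). M (vs ! i) (vs ! j)))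
     = (\<Sum>p | p permutes ?I. of_int (sign p) * (\<Prod>i\<in>?I. mat n n (\<lambda>(i, j). M (vs ! i) (vs ! j)) $$ (i, p i)))"
    by (simp add: det_def)
  also have "\<dots> = set_det M (set vs)"
    unfolding set_det_def
  proof (rule sum.reindex_bij_witness[of _ "map_permutation (set vs) ?g" "map_permutation ?I ?f"], goal_cases)
    case (1 p)
    then show ?case using bij inj by (intro map_permutation_compose_inv[of _ _ "set vs"]) auto
  next
    case (2 p)
    then show ?case using bij by (auto intro: map_permutation_permutes)
  next
    case (3 p)
    then show ?case using bij' bij by (intro map_permutation_compose_inv[of _ _ ?I]) (auto simp: f_inv_into_f bij_betw_def)
  next
    case (4 p)
    then show ?case using bij' by (auto intro: map_permutation_permutes)
  next
    case (5 p)
    then have p: "p permutes ?I" by simp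
    have s: "sign (map_permutation ?I ?f p) = sign p" using inj p by (intro sign_map_permutation) auto
    have "(\<Prod>v\<in>set vs. M v (map_permutation ?I ?f p v)) = (\<Prod>i\<in>?I. M (?f i) (map_permutation ?I ?f p (?f i)))"
      using bij by (rule prod.reindex_bij_betw[symmetric])
    also have "\<dots> = (\<Prod>i\<in>?I. M (?f i) (?f (p i)))"
      using inj by (intro prod.cong) (auto simp: map_permutation_apply)
    also have "\<dots> = (\<Prod>i\<in>?I. mat n n (\<lambda>(i, j). M (vs ! i) (vs ! j)) $$ (i, p i))"
      using permutes_in_image[OF p] by (intro prod.cong) auto
    finally show ?case using s by simp
  qed
  finally show ?thesis by (simp add: n_def)
qed

lemma graph_char_poly_eq:
  assumes "finite (verts G)"
  shows "graph_char_poly G = cpoly (\<lambda>u v. u \<rightarrow>\<^bsub>G\<^esub> v) (verts G)"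
proof -
  define vs where "vs = sorted_list_of_set (verts G)"
  have vs: "distinct vs" "set vs = verts G" using assms by (auto simp: vs_def)
  have "char_poly_matrix (adjacency_mat G)
    = mat (length vs) (length vs) (\<lambda>(i, j). char_entry (\<lambda>u v. u \<rightarrow>\<^bsub>G\<^esub> v) (vs ! i) (vs ! j))"
    unfolding char_poly_matrix_def adjacency_mat_def Let_def vs_def[symmetric]
    using vs by (intro eq_matI) (auto simp: char_entry_def nth_eq_iff_index_eq one_pCons)
  then show ?thesis
    unfolding graph_char_poly_def char_poly_def cpoly_def using set_det_eq_det[OF vs(1)] vs(2) by simp
qed

subsection \<open>Graphs realizing a rooted tree\<close>

text \<open>\<open>A\<close> hangs from the rest of \<open>V\<close> by the single edge between
  \<open>c\<close> and \<open>w\<close>. Both directions are spelled out because \<open>E\<close> is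
  an arbitrary relation; connectedness of \<open>A\<close> is expressed separately.\<close>

definition limb :: "('a \<Rightarrow> 'a \<Rightarrow> bool) \<Rightarrow> 'a set \<Rightarrow> 'a \<Rightarrow> 'a \<Rightarrow> 'a set \<Rightarrow> bool" where
  "limb E V w c A \<longleftrightarrow> A \<subseteq> V \<and> c \<in> A \<and> w \<in> V - A \<and>
     (\<forall>x\<in>A. \<forall>y\<in>V - A. (E x y \<longleftrightarrow> x = c \<and> y = w) \<and> (E y x \<longleftrightarrow> x = c \<and> y = w))"

lemma limbI:
  assumes "A \<subseteq> V" "c \<in> A" "w \<in> V" "w \<notin> A"
    and "\<And>x y. x \<in> A \<Longrightarrow> y \<in> V \<Longrightarrow> y \<notin> A \<Longrightarrow> (E x y \<longleftrightarrow> x = c \<and> y = w) \<and> (E y x \<longleftrightarrow> x = c \<and> y = w)"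
  shows "limb E V w c A"
  unfolding limb_def using assms by blast

lemma limbD:
  assumes "limb E V w c A"
  shows "A \<subseteq> V" "c \<in> A" "w \<in> V" "w \<notin> A" "E c w" "E w c"
  using assms unfolding limb_def by blast+

lemma limb_cross:
  assumes "limb E V w c A" "x \<in> A" "y \<in> V" "y \<notin> A"
  shows "E x y \<longleftrightarrow> x = c \<and> y = w" "E y x \<longleftrightarrow> x = c \<and> y = w"
  using assms unfolding limb_def by blast+

text \<open>The graph induced by \<open>E\<close> on \<open>V\<close>, rooted at \<open>r\<close>,
  is a tree isomorphic to \<open>t\<close>. It is built by attaching one branch at a time.\<close>

inductive realizes :: "('a \<Rightarrow> 'a \<Rightarrow> bool) \<Rightarrow> 'a set \<Rightarrow> 'a \<Rightarrow> rtree \<Rightarrow> bool" for E where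
  single: "\<not> E r r \<Longrightarrow> realizes E {r} r (Node {#})"
| attach: "realizes E V r (Node M) \<Longrightarrow> realizes E W c t \<Longrightarrow> V \<inter> W = {} \<Longrightarrow> limb E (V \<union> W) r c W \<Longrightarrow>
    realizes E (V \<union> W) r (Node (add_mset t M))"

lemma realizes_basic: "realizes E V r t \<Longrightarrow> r \<in> V \<and> finite V \<and> card V = tree_size t"
  by (induction rule: realizes.induct) (auto simp: card_Un_disjoint)

lemma realizes_sym: "realizes E V r t \<Longrightarrow> x \<in> V \<Longrightarrow> y \<in> V \<Longrightarrow> E x y \<Longrightarrow> E y x \<and> x \<noteq> y"
proof (induction arbitrary: x y rule: realizes.induct)
  case (attach V r M W c t)
  note cross = limb_cross[OF attach.hyps(4)]
  consider "x \<in> V" "y \<in> V" | "x \<in> W" "y \<in> W" | "x \<in> W" "y \<in> V" "y \<notin> W" | "x \<in> V" "x \<notin> W" "y \<in> W"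
    using attach.prems attach.hyps(3) by blast
  then show ?case
  proof cases
    case 1
    then show ?thesis using attach.IH(1) attach.prems by blast
  next
    case 2
    then show ?thesis using attach.IH(2) attach.prems by blast
  next
    case 3
    then show ?thesis using cross[of x y] attach.prems by auto
  next
    case 4
    then show ?thesis using cross[of y x] attach.prems by auto
  qed
qed auto

lemma limb_subset: "limb E V w c A \<Longrightarrow> U \<subseteq> V \<Longrightarrow> A \<subseteq> U \<Longrightarrow> w \<in> U \<Longrightarrow> limb E U w c A"
  unfolding limb_def by blast

text \<open>The new part \<open>W\<close> meets \<open>V\<close> only at \<open>r\<close>, which
  lies outside \<open>A\<close>.\<close>

lemma limb_sibling:
  assumes A: "limb E V r c A" and W: "limb E (V \<union> W) r d W" and disj: "V \<inter> W = {}"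
  shows "limb E (V \<union> W) r c A"
proof (rule limbI)
  fix x y assume xy: "x \<in> A" "y \<in> V \<union> W" "y \<notin> A"
  show "(E x y \<longleftrightarrow> x = c \<and> y = r) \<and> (E y x \<longleftrightarrow> x = c \<and> y = r)"
  proof (cases "y \<in> W")
    case True
    have "x \<in> V \<union> W" "x \<notin> W" "x \<noteq> r" "y \<noteq> r" using xy limbD[OF A] disj True by blast+
    then show ?thesis using limb_cross[OF W True, of x] by simp
  next
    case False
    then have "y \<in> V" using xy by simp
    then show ?thesis using limb_cross[OF A xy(1) _ xy(3)] by simp
  qed
qed (use limbD[OF A] in auto)

text \<open>The only edge leaving \<open>A\<close> starts at \<open>c\<close>, so a part of
  \<open>A\<close> without \<open>c\<close> gains no edges in \<open>V\<close>.\<close>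

lemma limb_trans:
  assumes A: "limb E V r c A" and D: "limb E A w d D" and c: "c \<notin> D"
  shows "limb E V w d D"
proof (rule limbI)
  fix x y assume xy: "x \<in> D" "y \<in> V" "y \<notin> D"
  have xA: "x \<in> A" "x \<noteq> c" using xy limbD[OF D] c by auto
  show "(E x y \<longleftrightarrow> x = d \<and> y = w) \<and> (E y x \<longleftrightarrow> x = d \<and> y = w)"
  proof (cases "y \<in> A")
    case True
    then show ?thesis using limb_cross[OF D xy(1) _ xy(3)] by simp
  next
    case False
    then have "y \<noteq> w" using limbD[OF D] by auto
    then show ?thesis using limb_cross[OF A xA(1) xy(2) False] xA by simp
  qed
qed (use limbD[OF A] limbD[OF D] in auto)

lemma limb_compl: "limb E V w c A \<Longrightarrow> limb E V c w (V - A)"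
  unfolding limb_def by blast

text \<open>The order of attachment does not matter: any branch may be taken as the last one
  attached.\<close>

lemma realizes_branch:
  assumes "realizes E U r t" "t = Node N" "X \<in># N"
  shows "\<exists>A c. limb E U r c A \<and> realizes E A c X \<and> realizes E (U - A) r (Node (N - {#X#}))"
  using assms
proof (induction arbitrary: N rule: realizes.induct)
  case (attach V r M W c t)
  have N: "N = add_mset t M" using attach.prems by simp
  show ?case
  proof (cases "X = t")
    case True
    then show ?thesis using attach N by (auto intro!: exI[of _ W] exI[of _ c] simp: Un_Diff Diff_triv)
  next
    case False
    then have X: "X \<in># M" using attach.prems N by auto
    from attach.IH(1)[OF refl X] obtain A d where A: "limb E V r d A" "realizes E A d X"
      "realizes E (V - A) r (Node (M - {#X#}))" by blast
    have AW: "A \<subseteq> V" "r \<in> V - A" using A by (auto simp: limb_def)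
    then have eq: "V \<union> W - A = (V - A) \<union> W" using attach.hyps by auto
    have "realizes E ((V - A) \<union> W) r (Node (add_mset t (M - {#X#})))"
    proof (rule realizes.attach)
      show "limb E (V - A \<union> W) r c W"
        by (rule limb_subset[OF attach.hyps(4)]) (use AW in auto)
    qed (use A attach.hyps in auto)
    moreover have "limb E (V \<union> W) r d A" by (rule limb_sibling[OF A(1) attach.hyps(4,3)])
    ultimately show ?thesis using A False X N unfolding eq[symmetric]
      by (intro exI[of _ A] exI[of _ d]) simp
  qed
qed simp

text \<open>The counterpart of \<open>realizes_branch\<close> in which the branch is selected by a
  neighbour of the root instead of its isomorphism type.\<close>

lemma realizes_neighbour:
  assumes "realizes E U r t" "t = Node N" "E r c" "c \<in> U"
  shows "\<exists>A X. X \<in># N \<and> limb E U r c A \<and> realizes E A c X \<and> realizes E (U - A) r (Node (N - {#X#}))"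
  using assms
proof (induction arbitrary: N rule: realizes.induct)
  case (attach V r M W d t)
  have N: "N = add_mset t M" using attach.prems by simp
  show ?case
  proof (cases "c \<in> W")
    case True
    moreover have "r \<in> V \<union> W" "r \<notin> W" using limbD[OF attach.hyps(4)] by auto
    ultimately have "c = d" using limb_cross(2)[OF attach.hyps(4), of c r] attach.prems by simp
    then show ?thesis using attach N by (auto intro!: exI[of _ W] exI[of _ t] simp: Un_Diff Diff_triv)
  next
    case False
    then have "c \<in> V" using attach.prems by auto
    from attach.IH(1)[OF refl \<open>E r c\<close> this] obtain A X where A: "X \<in># M" "limb E V r c A" "realizes E A c X"
      "realizes E (V - A) r (Node (M - {#X#}))" by blast
    have AW: "A \<subseteq> V" "r \<in> V - A" using A by (auto simp: limb_def)
    then have eq: "V \<union> W - A = (V - A) \<union> W" using attach.hyps by auto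
    have "realizes E ((V - A) \<union> W) r (Node (add_mset t (M - {#X#})))"
    proof (rule realizes.attach)
      show "limb E (V - A \<union> W) r d W"
        by (rule limb_subset[OF attach.hyps(4)]) (use AW in auto)
    qed (use A attach.hyps in auto)
    moreover have "limb E (V \<union> W) r c A" by (rule limb_sibling[OF A(2) attach.hyps(4,3)])
    moreover have "N - {#X#} = add_mset t (M - {#X#})" using diff_union_swap2[OF A(1)] N by simp
    moreover have "X \<in># N" using A(1) N by simp
    ultimately show ?thesis using A(3) unfolding eq[symmetric] by metis
  qed
qed simp

section \<open>Connectedness through closed vertex sets, and uniqueness of limbs\<close>

definition conn :: "('a \<Rightarrow> 'a \<Rightarrow> bool) \<Rightarrow> 'a set \<Rightarrow> bool" where
  "conn E V \<longleftrightarrow> (\<forall>S\<subseteq>V. S \<noteq> {} \<longrightarrow> (\<forall>x\<in>S. \<forall>y\<in>V. E x y \<longrightarrow> y \<in> S) \<longrightarrow> S = V)"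

lemma connD: "conn E V \<Longrightarrow> S \<subseteq> V \<Longrightarrow> s \<in> S \<Longrightarrow> (\<And>x y. x \<in> S \<Longrightarrow> y \<in> V \<Longrightarrow> E x y \<Longrightarrow> y \<in> S) \<Longrightarrow> S = V"
  unfolding conn_def by blast

text \<open>A closed subset of \<open>A\<close> containing \<open>c\<close> becomes closed in
  \<open>V\<close> after adding \<open>V - A\<close>. One without \<open>c\<close> is already closed
  in \<open>V\<close>, hence all of \<open>V\<close>, which is impossible as it misses
  \<open>w\<close>.\<close>

lemma conn_limb:
  assumes "conn E V" "limb E V w c A"
  shows "conn E A"
  unfolding conn_def
proof (intro allI impI)
  fix K assume K: "K \<subseteq> A" "K \<noteq> {}" "\<forall>x\<in>K. \<forall>y\<in>A. E x y \<longrightarrow> y \<in> K"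
  then obtain s where s: "s \<in> K" by blast
  note D = limbD[OF assms(2)] and cross = limb_cross[OF assms(2)]
  show "K = A"
  proof (cases "c \<in> K")
    case True
    have "K \<union> (V - A) = V"
    proof (rule connD[OF assms(1), of _ s])
      fix x y assume xy: "x \<in> K \<union> (V - A)" "y \<in> V" "E x y"
      then show "y \<in> K \<union> (V - A)" using cross(2)[of y x] K True by blast
    qed (use K D s in auto)
    then show ?thesis using K D by blast
  next
    case False
    have "K = V"
    proof (rule connD[OF assms(1) _ s])
      fix x y assume xy: "x \<in> K" "y \<in> V" "E x y"
      then show "y \<in> K" using cross(1)[of x y] K False by blast
    qed (use K D in auto)
    then show ?thesis using K D by blast
  qed
qed

lemma conn_limb_compl: "conn E V \<Longrightarrow> limb E V w c A \<Longrightarrow> conn E (V - A)"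
  using conn_limb limb_compl by metis

lemma realizes_conn: "realizes E V r t \<Longrightarrow> conn E V"
proof (induction rule: realizes.induct)
  case (single r)
  then show ?case by (auto simp: conn_def)
next
  case (attach V r M W c t)
  have rc: "r \<in> V" "c \<in> W" "E r c" "E c r" using limbD[OF attach.hyps(4)] by auto
  show ?case unfolding conn_def
  proof (intro allI impI)
    fix S assume S: "S \<subseteq> V \<union> W" "S \<noteq> {}" "\<forall>x\<in>S. \<forall>y\<in>V \<union> W. E x y \<longrightarrow> y \<in> S"
    have V: "S \<inter> V = V" if "s \<in> S \<inter> V" for s
      by (rule connD[OF attach.IH(1) _ that]) (use S in auto)
    have W: "S \<inter> W = W" if "s \<in> S \<inter> W" for s
      by (rule connD[OF attach.IH(2) _ that]) (use S in auto)
    show "S = V \<union> W" using V W S rc by blast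
  qed
qed

text \<open>Leaving \<open>B\<close> from inside \<open>A\<close> would lead to \<open>w\<close>,
  which is not in \<open>A\<close>; so \<open>A \<inter> B\<close> is closed in the connected set
  \<open>A\<close>.\<close>

lemma limb_unique_subset:
  assumes A: "limb E V w c A" "conn E A" and B: "limb E V w c B"
  shows "A \<subseteq> B"
proof -
  have "A \<inter> B = A"
  proof (rule connD[OF A(2)])
    show "c \<in> A \<inter> B" using limbD(2)[OF A(1)] limbD(2)[OF B] by simp
    fix x y assume "x \<in> A \<inter> B" "y \<in> A" "E x y"
    then show "y \<in> A \<inter> B" using limb_cross(1)[OF B, of x y] limbD[OF A(1)] by blast
  qed auto
  then show ?thesis by blast
qed

lemma limb_unique: "limb E V w c A \<Longrightarrow> conn E A \<Longrightarrow> limb E V w c B \<Longrightarrow> conn E B \<Longrightarrow> A = B"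
  by (simp add: limb_unique_subset subset_antisym)

text \<open>\<open>B\<close> can only be entered from \<open>w\<close>, which is not in
  \<open>A\<close>; so \<open>A - B\<close> is closed in \<open>A\<close>, and it contains
  \<open>a\<close> because \<open>w\<close> has only the neighbour \<open>b\<close> in
  \<open>B\<close>.\<close>

lemma limb_disjoint:
  assumes A: "limb E V w a A" "conn E A" and B: "limb E V w b B" and "a \<noteq> b"
  shows "A \<inter> B = {}"
proof -
  note DA = limbD[OF A(1)] and DB = limbD[OF B]
  have "a \<notin> B" using limb_cross(2)[OF B, of a w] DA DB \<open>a \<noteq> b\<close> by blast
  have "A - B = A"
  proof (rule connD[OF A(2)])
    show "a \<in> A - B" using DA \<open>a \<notin> B\<close> by simp
    fix x y assume "x \<in> A - B" "y \<in> A" "E x y"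
    then show "y \<in> A - B" using limb_cross(2)[OF B, of y x] DA by blast
  qed auto
  then show ?thesis by blast
qed

text \<open>By \<open>limb_unique\<close> the neighbour \<open>c\<close> of the root determines its
  branch as a vertex set, so both derivations can strip the same branch.\<close>

lemma realizes_unique: "realizes E V r t \<Longrightarrow> realizes E V r t' \<Longrightarrow> t = t'"
proof (induction arbitrary: t' rule: realizes.induct)
  case (single r)
  then have "tree_size t' = 1" using realizes_basic by fastforce
  then show ?case by (cases t' rule: rtree_attach_cases) auto
next
  case (attach V r M W c t)
  obtain N where N: "t' = Node N" by (cases t')
  have rc: "E r c" "c \<in> V \<union> W" using limbD[OF attach.hyps(4)] by auto
  from realizes_neighbour[OF attach.prems N rc] obtain A X where
    A: "X \<in># N" "limb E (V \<union> W) r c A" "realizes E A c X" "realizes E (V \<union> W - A) r (Node (N - {#X#}))" by blast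
  have "A = W" by (rule limb_unique[OF A(2) realizes_conn[OF A(3)] attach.hyps(4) realizes_conn[OF attach.hyps(2)]])
  then have "V \<union> W - A = V" using attach.hyps by auto
  then have "t = X" "Node M = Node (N - {#X#})" using attach.IH A \<open>A = W\<close> by auto
  then show ?case using A N by simp
qed

section \<open>Transport of limbs and realizations along isomorphisms\<close>

lemma limb_image:
  assumes l: "limb E V w c A" and inj: "inj_on f V"
    and E: "\<And>x y. x \<in> V \<Longrightarrow> y \<in> V \<Longrightarrow> E x y \<longleftrightarrow> E' (f x) (f y)"
  shows "limb E' (f ` V) (f w) (f c) (f ` A)"
proof (rule limbI)
  note D = limbD[OF l]
  have inA: "f z \<in> f ` A \<longleftrightarrow> z \<in> A" if "z \<in> V" for z
    using inj_on_image_mem_iff[OF inj that D(1)] .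
  show "f ` A \<subseteq> f ` V" "f c \<in> f ` A" "f w \<in> f ` V" "f w \<notin> f ` A"
    using D inA by auto
  fix x' y' assume "x' \<in> f ` A" "y' \<in> f ` V" "y' \<notin> f ` A"
  then obtain x y where xy: "x' = f x" "x \<in> A" "y' = f y" "y \<in> V" "y \<notin> A" by blast
  then have "x \<in> V" "c \<in> V" using D by auto
  then have "f x = f c \<longleftrightarrow> x = c" "f y = f w \<longleftrightarrow> y = w"
    using xy D(3) inj by (auto simp: inj_on_eq_iff)
  then show "(E' x' y' \<longleftrightarrow> x' = f c \<and> y' = f w) \<and> (E' y' x' \<longleftrightarrow> x' = f c \<and> y' = f w)"
    using limb_cross[OF l xy(2,4,5)] E[OF \<open>x \<in> V\<close> xy(4)] E[OF xy(4) \<open>x \<in> V\<close>] xy by simp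
qed

lemma realizes_image:
  assumes "realizes E V r t" "inj_on f V" "\<And>x y. x \<in> V \<Longrightarrow> y \<in> V \<Longrightarrow> E x y \<longleftrightarrow> E' (f x) (f y)"
  shows "realizes E' (f ` V) (f r) t"
  using assms
proof (induction rule: realizes.induct)
  case (single r)
  then show ?case by (auto intro: realizes.single)
next
  case (attach V r M W c t)
  have "realizes E' (f ` V \<union> f ` W) (f r) (Node (add_mset t M))"
  proof (rule realizes.attach)
    show "realizes E' (f ` V) (f r) (Node M)" "realizes E' (f ` W) (f c) t"
      using inj_on_subset[OF attach.prems(1)] attach.prems(2) by (simp_all add: attach.IH)
    show "f ` V \<inter> f ` W = {}"
      using inj_on_image_Int[OF attach.prems(1), of V W] attach.hyps(3) by simp
    show "limb E' (f ` V \<union> f ` W) (f r) (f c) (f ` W)"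
      using limb_image[OF attach.hyps(4) attach.prems(1), of E'] attach.prems(2) by (simp add: image_Un)
  qed
  then show ?case by (simp add: image_Un)
qed

text \<open>The isomorphism is glued from one on the branch and one on the rest. It respects edges
  across because the single edge from \<open>c\<close> to \<open>r\<close> corresponds to the one
  from \<open>d\<close> to \<open>r'\<close>.\<close>

lemma realizes_iso:
  assumes "realizes E V r t" "realizes E' V' r' t"
  shows "\<exists>f. bij_betw f V V' \<and> f r = r' \<and> (\<forall>x\<in>V. \<forall>y\<in>V. E x y \<longleftrightarrow> E' (f x) (f y))"
  using assms
proof (induction arbitrary: V' r' rule: realizes.induct)
  case (single r)
  have "card V' = 1" "r' \<in> V'" "\<not> E' r' r'"
    using realizes_basic[OF single(2)] realizes_sym[OF single(2)] by auto
  then have "V' = {r'}" by (auto simp: card_1_singleton_iff)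
  then show ?case using single \<open>\<not> E' r' r'\<close> by (auto intro!: exI[of _ "\<lambda>_. r'"] simp: bij_betw_def)
next
  case (attach V r M W c t)
  from realizes_branch[OF attach.prems refl, of t] obtain A d where
    A: "limb E' V' r' d A" "realizes E' A d t" "realizes E' (V' - A) r' (Node M)" by auto
  from attach.IH(1)[OF A(3)] obtain f where f: "bij_betw f V (V' - A)" "f r = r'"
    "\<forall>x\<in>V. \<forall>y\<in>V. E x y \<longleftrightarrow> E' (f x) (f y)" by blast
  from attach.IH(2)[OF A(2)] obtain g where g: "bij_betw g W A" "g c = d"
    "\<forall>x\<in>W. \<forall>y\<in>W. E x y \<longleftrightarrow> E' (g x) (g y)" by blast
  define h where "h x = (if x \<in> W then g x else f x)" for x
  have disj: "V \<inter> W = {}" by fact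
  have hV: "h x = f x" "f x \<in> V' - A" if "x \<in> V" for x
    using that f(1) disj by (auto simp: h_def bij_betw_def)
  have hW: "h x = g x" "g x \<in> A" if "x \<in> W" for x
    using that g(1) by (auto simp: h_def bij_betw_def)
  have "bij_betw h V (V' - A)" using f(1) hV(1) by (simp cong: bij_betw_cong)
  moreover have "bij_betw h W A" using g(1) hW(1) by (simp cong: bij_betw_cong)
  ultimately have "bij_betw h (V \<union> W) ((V' - A) \<union> A)" by (rule bij_betw_combine) auto
  moreover have "(V' - A) \<union> A = V'" using limbD(1)[OF A(1)] by blast
  ultimately have bij: "bij_betw h (V \<union> W) V'" by simp
  have r: "r \<in> V" "c \<in> W" using limbD[OF attach.hyps(4)] by auto
  have cross: "(E x y \<longleftrightarrow> E' (h x) (h y)) \<and> (E y x \<longleftrightarrow> E' (h y) (h x))" if "x \<in> W" "y \<in> V" for x y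
  proof -
    have "y \<notin> W" using that disj by auto
    then have "(E x y \<longleftrightarrow> x = c \<and> y = r) \<and> (E y x \<longleftrightarrow> x = c \<and> y = r)"
      using limb_cross[OF attach.hyps(4) that(1), of y] that by simp
    moreover have "(E' (g x) (f y) \<longleftrightarrow> g x = d \<and> f y = r') \<and> (E' (f y) (g x) \<longleftrightarrow> g x = d \<and> f y = r')"
      using limb_cross[OF A(1) hW(2)[OF that(1)], of "f y"] hV(2)[OF that(2)] by simp
    moreover have "g x = d \<longleftrightarrow> x = c" "f y = r' \<longleftrightarrow> y = r"
      using f g r that by (auto simp: bij_betw_def inj_on_eq_iff)
    ultimately show ?thesis using hV(1)[OF that(2)] hW(1)[OF that(1)] by simp
  qed
  have "E x y \<longleftrightarrow> E' (h x) (h y)" if "x \<in> V \<union> W" "y \<in> V \<union> W" for x y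
  proof -
    consider "x \<in> V" "y \<in> V" | "x \<in> W" "y \<in> W" | "x \<in> W" "y \<in> V" | "x \<in> V" "y \<in> W"
      using \<open>x \<in> V \<union> W\<close> \<open>y \<in> V \<union> W\<close> by blast
    then show ?thesis
    proof cases
      case 1
      then show ?thesis using f(3) hV(1) by simp
    next
      case 2
      then show ?thesis using g(3) hW(1) by simp
    qed (use cross in blast)+
  qed
  moreover have "h r = r'" using hV(1)[OF r(1)] f(2) by simp
  ultimately show ?case using bij by blast
qed

section \<open>Acyclicity, and the existence of realizations\<close>

definition reach :: "('a \<Rightarrow> 'a \<Rightarrow> bool) \<Rightarrow> 'a set \<Rightarrow> 'a \<Rightarrow> 'a \<Rightarrow> bool" where
  "reach E S = (\<lambda>x y. x \<in> S \<and> y \<in> S \<and> E x y)\<^sup>*\<^sup>*"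

text \<open>Acyclicity in a form that is visibly inherited by subsets of the vertices.\<close>
definition acy :: "('a \<Rightarrow> 'a \<Rightarrow> bool) \<Rightarrow> 'a set \<Rightarrow> bool" where
  "acy E V \<longleftrightarrow> (\<forall>p\<in>V. \<forall>x\<in>V. \<forall>y\<in>V. E p x \<longrightarrow> E p y \<longrightarrow> x \<noteq> y \<longrightarrow> \<not> reach E (V - {p}) x y)"

lemma reach_mono: "reach E S x y \<Longrightarrow> S \<subseteq> T \<Longrightarrow> reach E T x y"
  unfolding reach_def by (erule rtranclp_mono[THEN predicate2D, rotated]) auto

lemma acy_subset: "acy E V \<Longrightarrow> U \<subseteq> V \<Longrightarrow> acy E U"
  unfolding acy_def by (meson Diff_mono order_refl reach_mono subsetD)

text \<open>Attaching a limb creates no cycle through a vertex \<open>p\<close> outside it. If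
  \<open>p\<close> is \<open>r\<close>, removing it cuts off \<open>W\<close>, where
  \<open>r\<close> has only the neighbour \<open>c\<close>; otherwise an excursion into
  \<open>W\<close> starts and ends at \<open>r\<close> and can be contracted.\<close>

lemma acy_limb:
  assumes l: "limb E U r c W" and acy: "acy E (U - W)" and p: "p \<in> U - W"
    and xy: "x \<in> U" "y \<in> U" "E p x" "E p y" "reach E (U - {p}) x y"
  shows "x = y"
proof -
  have rc: "r \<in> U - W" "c \<in> W" and W: "W \<subseteq> U" using limbD[OF l] by auto
  have cross: "(E a b \<longleftrightarrow> a = c \<and> b = r) \<and> (E b a \<longleftrightarrow> a = c \<and> b = r)" if "a \<in> W" "b \<in> U - W" for a b
    using limb_cross[OF l that(1), of b] that by simp
  define V where "V = U - W"
  show ?thesis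
  proof (cases "p = r")
    case False
    \<comment> \<open>\<open>h\<close> contracts \<open>W\<close> to \<open>r\<close>: edges inside
      \<open>W\<close> and the bridge collapse, all other edges stay.\<close>
    define h where "h z = (if z \<in> W then r else z)" for z
    have "x \<notin> W" "y \<notin> W" using cross[OF _ p] xy False by blast+
    have "reach E (V - {p}) (h x) (h y)"
      using xy(5) unfolding reach_def
    proof (induction rule: rtranclp_induct)
      case (step a b)
      have "h a = h b \<or> (h a \<in> V - {p} \<and> h b \<in> V - {p} \<and> E (h a) (h b))"
        using step(2) cross[of a b] cross[of b a] by (auto simp: h_def V_def)
      then show ?case using step.IH by (metis (mono_tags, lifting) rtranclp.rtrancl_into_rtrancl)
    qed simp
    then have "reach E (V - {p}) x y" using \<open>x \<notin> W\<close> \<open>y \<notin> W\<close> by (simp add: h_def)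
    then show ?thesis using acy xy p \<open>x \<notin> W\<close> \<open>y \<notin> W\<close> unfolding acy_def V_def by blast
  next
    case True
    have *: "(x \<in> W \<longleftrightarrow> y \<in> W) \<and> (x \<notin> W \<longrightarrow> reach E (V - {p}) x y)"
      using xy(5) unfolding reach_def
    proof (induction rule: rtranclp_induct)
      case (step a b)
      have "(a \<in> W \<longleftrightarrow> b \<in> W)" "a \<notin> W \<longrightarrow> a \<in> V - {p} \<and> b \<in> V - {p} \<and> E a b"
        using step(2) cross[of a b] cross[of b a] True by (auto simp: V_def)
      then show ?case using step.IH by (metis (mono_tags, lifting) rtranclp.rtrancl_into_rtrancl)
    qed simp
    show ?thesis
    proof (cases "x \<in> W")
      case True
      then have "y \<in> W" using * by simp
      then show ?thesis using cross[OF _ p] xy True by blast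
    next
      case False
      then show ?thesis using * acy xy p unfolding acy_def V_def by blast
    qed
  qed
qed

lemma realizes_acy: "realizes E V r t \<Longrightarrow> acy E V"
proof (induction rule: realizes.induct)
  case (single r)
  then show ?case by (auto simp: acy_def)
next
  case (attach V r M W c t)
  let ?U = "V \<union> W"
  have V: "?U - W = V" "?U - V = W" using attach.hyps(3) by auto
  have l: "limb E ?U r c W" by fact
  \<comment> \<open>Seen from the other end of the bridge, \<open>V\<close> is a limb attached at
    \<open>c\<close>, so \<open>acy_limb\<close> also covers \<open>p\<close> in
    \<open>W\<close>.\<close>
  then have l': "limb E ?U c r V" using limb_compl V(1) by metis
  show ?case unfolding acy_def
  proof (intro ballI impI notI)
    fix p x y assume *: "p \<in> ?U" "x \<in> ?U" "y \<in> ?U" "E p x" "E p y" "x \<noteq> y" "reach E (?U - {p}) x y"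
    show False
    proof (cases "p \<in> W")
      case True
      then show False using acy_limb[OF l' _ _ *(2,3,4,5,7)] attach.IH(2) V * by simp
    next
      case False
      then show False using acy_limb[OF l _ _ *(2,3,4,5,7)] attach.IH(1) V * by simp
    qed
  qed
qed

text \<open>Choose a neighbour \<open>c\<close> of \<open>r\<close> and let \<open>W\<close> be its
  component after deleting \<open>r\<close>. Acyclicity makes \<open>c\<close> the only neighbour of
  \<open>r\<close> in \<open>W\<close>, so \<open>W\<close> is a limb, and induction applies to
  \<open>W\<close> and to \<open>V - W\<close>.\<close>

lemma realizes_exists:
  assumes "finite V" "r \<in> V" "conn E V" "acy E V"
    and "\<And>x y. x \<in> V \<Longrightarrow> y \<in> V \<Longrightarrow> E x y \<Longrightarrow> E y x \<and> x \<noteq> y"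
  shows "\<exists>t. realizes E V r t"
  using assms
proof (induction "card V" arbitrary: V r rule: less_induct)
  case less
  show ?case
  proof (cases "V = {r}")
    case True
    then have "\<not> E r r" using less.prems(5) by blast
    then show ?thesis using True by (auto intro: realizes.single)
  next
    case False
    have "\<exists>c\<in>V. c \<noteq> r \<and> E r c"
    proof (rule ccontr)
      assume "\<not> ?thesis"
      then have "{r} = V" by (intro connD[OF less.prems(3), of _ r]) (use less.prems(2) in blast)+
      then show False using False by simp
    qed
    then obtain c where c: "c \<in> V" "c \<noteq> r" "E r c" by blast
    define W where "W = {y \<in> V - {r}. reach E (V - {r}) c y}"
    have cW: "c \<in> W" using c by (simp add: W_def reach_def)
    have closed: "y \<in> W" if "x \<in> W" "y \<in> V - {r}" "E x y" for x y
      using that unfolding W_def reach_def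
      by (auto intro: rtranclp.rtrancl_into_rtrancl)
    have nbr: "x = c" if "x \<in> W" "E r x" for x
      using less.prems(4) less.prems(2) c that unfolding acy_def W_def by blast
    have l: "limb E V r c W"
    proof (rule limbI)
      fix x y assume xy: "x \<in> W" "y \<in> V" "y \<notin> W"
      then have V: "x \<in> V" "y \<in> V" by (auto simp: W_def)
      have "E x y \<longleftrightarrow> E y x" using less.prems(5) V by blast
      moreover have "E x y \<longleftrightarrow> x = c \<and> y = r"
      proof
        assume "E x y"
        then have "y = r" using closed xy by blast
        then show "x = c \<and> y = r" using nbr xy \<open>E x y\<close> less.prems(5) V by blast
      next
        assume "x = c \<and> y = r"
        then show "E x y" using less.prems(5) c V by blast
      qed
      ultimately show "(E x y \<longleftrightarrow> x = c \<and> y = r) \<and> (E y x \<longleftrightarrow> x = c \<and> y = r)" by simp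
    qed (use less.prems(2) cW in \<open>auto simp: W_def\<close>)
    have sub: "W \<subseteq> V" "r \<in> V - W" "V = (V - W) \<union> W" using less.prems by (auto simp: W_def)
    have card: "card W < card V" "card (V - W) < card V"
      using sub cW less.prems(1) by (auto intro!: psubset_card_mono)
    have "\<exists>t. realizes E W c t"
    proof (rule less.hyps[OF card(1)])
      show "finite W" "conn E W" "acy E W"
        using finite_subset[OF sub(1) less.prems(1)] conn_limb[OF less.prems(3) l]
          acy_subset[OF less.prems(4) sub(1)] by auto
    qed (use cW sub less.prems(5) in blast)+
    moreover have "\<exists>t. realizes E (V - W) r t"
    proof (rule less.hyps[OF card(2)])
      show "finite (V - W)" "conn E (V - W)" "acy E (V - W)"
        using less.prems(1) conn_limb_compl[OF less.prems(3) l]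
          acy_subset[OF less.prems(4) Diff_subset] by auto
    qed (use sub less.prems(5) in blast)+
    ultimately obtain t M where "realizes E W c t" "realizes E (V - W) r (Node M)" by (metis rtree.exhaust)
    then have "realizes E ((V - W) \<union> W) r (Node (add_mset t M))"
      using l sub(3) by (intro realizes.attach[where c = c]) auto
    then show ?thesis using sub(3) by metis
  qed
qed

text \<open>The branch is shifted behind the first \<open>a\<close> vertices and joined by the edge
  between \<open>0\<close> and \<open>a\<close>.\<close>

lemma realization_exists: "\<exists>E. realizes E {..<tree_size t} (0::nat) t"
proof (induction "tree_size t" arbitrary: t rule: less_induct)
  case less
  show ?case
  proof (cases t rule: rtree_attach_cases)
    case 1
    have "realizes (\<lambda>_ _. False) {0::nat} 0 (Node {#})" by (rule realizes.single) simp
    then show ?thesis using 1 by (auto simp: lessThan_Suc)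
  next
    case (2 c M)
    define a where "a = tree_size (Node M)"
    define b where "b = tree_size c"
    have size: "tree_size t = a + b" "tree_size c < tree_size t" "tree_size (Node M) < tree_size t"
      using 2 by (auto simp: a_def b_def)
    have a: "a > 0" by (simp add: a_def)
    have b: "b > 0" by (simp add: b_def)
    obtain E1 where E1: "realizes E1 {..<a} 0 (Node M)" using less size unfolding a_def by blast
    obtain E2 where E2: "realizes E2 {..<b} 0 c" using less size unfolding b_def by blast
    define E where "E x y = (if x < a \<and> y < a then E1 x y else if a \<le> x \<and> a \<le> y then E2 (x - a) (y - a)
      else (x = 0 \<and> y = a) \<or> (x = a \<and> y = 0))" for x y
    have "realizes E ((\<lambda>x. x) ` {..<a}) 0 (Node M)"
      by (rule realizes_image[OF E1]) (auto simp: E_def)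
    moreover have "realizes E ((\<lambda>x. x + a) ` {..<b}) (0 + a) c"
      by (rule realizes_image[OF E2]) (auto simp: E_def)
    moreover have im: "(\<lambda>x. x + a) ` {..<b} = {a..<a + b}"
      using image_add_atLeastLessThan'[of a 0 b] by (simp add: atLeast0LessThan add.commute)
    moreover have un: "{..<a} \<union> {a..<a + b} = {..<a + b}" by auto
    moreover have "limb E ({..<a} \<union> {a..<a + b}) 0 a {a..<a + b}"
      using a b by (intro limbI) (auto simp: E_def)
    ultimately have "realizes E ({..<a} \<union> {a..<a + b}) 0 (Node (add_mset c M))"
      by (intro realizes.attach[where c = a]) auto
    then show ?thesis using un 2 size by auto
  qed
qed

text \<open>The root of the subtree is realized by some \<open>w\<close>, and the branches below
  \<open>w\<close> are limbs of the whole graph. The clause \<open>r \<notin> A\<close> is what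
  \<open>limb_trans\<close> asks for in the induction.\<close>

lemma realizes_subtree:
  "realizes E V r t \<Longrightarrow> Node M \<in> subtrees t \<Longrightarrow>
    \<exists>w\<in>V. \<forall>X\<in>#M. \<exists>A c. limb E V w c A \<and> realizes E A c X \<and> r \<notin> A"
proof (induction t arbitrary: V r)
  case (Node N)
  show ?case
  proof (cases "M = N")
    case True
    show ?thesis
    proof (intro bexI ballI)
      show "r \<in> V" using realizes_basic[OF Node.prems(1)] by simp
      fix X assume "X \<in># M"
      then show "\<exists>A c. limb E V r c A \<and> realizes E A c X \<and> r \<notin> A"
        using realizes_branch[OF Node.prems(1) refl, of X] True limbD(4) by fast
    qed
  next
    case False
    then obtain Y where Y: "Y \<in># N" "Node M \<in> subtrees Y" using Node.prems by auto
    from realizes_branch[OF Node.prems(1) refl Y(1)] obtain B d where B: "limb E V r d B" "realizes E B d Y" by blast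
    from Node.IH[OF Y(1) B(2) Y(2)] obtain w where
      w: "w \<in> B" "\<forall>X\<in>#M. \<exists>A c. limb E B w c A \<and> realizes E A c X \<and> d \<notin> A" by blast
    show ?thesis
    proof (intro bexI ballI)
      show "w \<in> V" using w(1) limbD(1)[OF B(1)] by blast
      fix X assume "X \<in># M"
      then obtain A c where A: "limb E B w c A" "realizes E A c X" "d \<notin> A" using w by blast
      moreover have "limb E V w c A" by (rule limb_trans[OF B(1) A(1,3)])
      moreover have "r \<notin> A" using limbD(1)[OF A(1)] limbD(4)[OF B(1)] by blast
      ultimately show "\<exists>A c. limb E V w c A \<and> realizes E A c X \<and> r \<notin> A" by blast
    qed
  qed
qed

text \<open>The pair consists of the characteristic polynomials of the tree and of the tree without
  its root. A relation avoids showing that the result is independent of the order of the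
  branches.\<close>

inductive cpolys :: "rtree \<Rightarrow> int poly \<Rightarrow> int poly \<Rightarrow> bool" where
  leaf: "cpolys (Node {#}) [:0, 1:] 1"
| attach: "cpolys (Node M) f g \<Longrightarrow> cpolys t f' g' \<Longrightarrow> cpolys (Node (add_mset t M)) (f * f' - g * g') (g * f')"

text \<open>\<open>cpoly_bridge\<close> at the edge from the root to a branch gives the first
  polynomial. Deleting the root detaches the branch, and \<open>cpoly_union\<close> gives the
  second.\<close>

lemma cpolys_realizes:
  "cpolys t f g \<Longrightarrow> realizes E V r t \<Longrightarrow> cpoly E V = f \<and> cpoly E (V - {r}) = g"
proof (induction arbitrary: V r rule: cpolys.induct)
  case leaf
  have "card V = 1" "r \<in> V" "\<not> E r r"
    using realizes_basic[OF leaf] realizes_sym[OF leaf] by auto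
  then have "V = {r}" by (auto simp: card_1_singleton_iff)
  then show ?case using \<open>\<not> E r r\<close> by (simp add: cpoly_singleton cpoly_empty)
next
  case (attach M f g t f' g')
  from realizes_branch[OF attach.prems refl, of t] obtain A c where
    A: "limb E V r c A" "realizes E A c t" "realizes E (V - A) r (Node M)" by auto
  have V: "V = (V - A) \<union> A" "V - {r} = (V - A - {r}) \<union> A" using limbD[OF A(1)] by blast+
  have fin: "finite V" using realizes_basic[OF attach.prems] by simp
  then have finA: "finite A" using V(1) by (metis finite_Un)
  have "cpoly E V = cpoly E (V - A) * cpoly E A - cpoly E (V - A - {r}) * cpoly E (A - {c})"
    by (subst V(1), rule cpoly_bridge) (use limbD[OF A(1)] limb_cross[OF A(1)] fin finA in auto)
  moreover have "cpoly E (V - {r}) = cpoly E (V - A - {r}) * cpoly E A"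
    by (subst V(2), rule cpoly_union) (use limb_cross[OF A(1)] fin finA in auto)
  ultimately show ?case using attach.IH(1)[OF A(3)] attach.IH(2)[OF A(2)] by simp
qed

text \<open>Deleting \<open>a\<close> splits off \<open>A - {a}\<close>, which contributes
  \<open>g\<close>; in what remains, expand at the bridge to \<open>B\<close>. The result, stated in
  \<open>half\<close>, is symmetric in the two limbs.\<close>

lemma limbs_cospectral:
  assumes fin: "finite V" and A: "limb E V w a A" "realizes E A a X" "cpolys X f g"
    and B: "limb E V w b B" "realizes E B b Y" "cpolys Y f g" and "a \<noteq> b"
  shows "cpoly E (V - {a}) = cpoly E (V - {b})"
proof -
  have half: "cpoly E (V - {a}) = g * (cpoly E (V - A - B) * f - cpoly E (V - A - B - {w}) * g)"
    if A: "limb E V w a A" "realizes E A a X" "cpolys X f g"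
      and B: "limb E V w b B" "realizes E B b Y" "cpolys Y f g" and "a \<noteq> b" for a b A B X Y
  proof -
    have disj: "A \<inter> B = {}" using limb_disjoint[OF A(1) realizes_conn[OF A(2)] B(1) \<open>a \<noteq> b\<close>] .
    have finAB: "finite A" "finite B" using realizes_basic A(2) B(2) by metis+
    note DA = limbD[OF A(1)] and DB = limbD[OF B(1)]
    note crossA = limb_cross[OF A(1)] and crossB = limb_cross[OF B(1)]
    have "V - {a} = (A - {a}) \<union> (V - A)" using DA by blast
    moreover have "cpoly E ((A - {a}) \<union> (V - A)) = cpoly E (A - {a}) * cpoly E (V - A)"
      by (rule cpoly_union) (use crossA fin finAB in auto)
    moreover have "V - A = (V - A - B) \<union> B" using disj DB by blast
    moreover have "cpoly E ((V - A - B) \<union> B)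
      = cpoly E (V - A - B) * cpoly E B - cpoly E (V - A - B - {w}) * cpoly E (B - {b})"
      by (rule cpoly_bridge) (use DA DB crossB fin finAB in auto)
    ultimately show ?thesis
      using cpolys_realizes[OF A(3,2)] cpolys_realizes[OF B(3,2)] by metis
  qed
  show ?thesis using half[OF A B \<open>a \<noteq> b\<close>] half[OF B A] \<open>a \<noteq> b\<close> by (simp add: Diff_eq Int_ac)
qed

text \<open>If the automorphism fixes \<open>w\<close>, it takes \<open>A\<close> to
  \<open>B\<close> by uniqueness of limbs, so \<open>X = Y\<close>. If not, the edge from
  \<open>b\<close> to \<open>w\<close> lies inside the image of \<open>A\<close>; this image then
  contains the connected set \<open>V - B\<close>, so the image and \<open>B\<close> cover
  \<open>V\<close>, which is too large for that.\<close>

lemma limbs_not_similar: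
  assumes fin: "finite V" and conn: "conn E V" and A: "limb E V w a A" "realizes E A a X"
    and B: "limb E V w b B" "realizes E B b Y"
    and f: "bij_betw f V V" "\<And>x y. x \<in> V \<Longrightarrow> y \<in> V \<Longrightarrow> E x y \<longleftrightarrow> E (f x) (f y)" "f a = b"
    and large: "tree_size X + tree_size Y < card V"
  shows "X = Y"
proof -
  have inj: "inj_on f V" and im: "f ` V = V" using f(1) by (auto simp: bij_betw_def)
  have AV: "A \<subseteq> V" "a \<in> A" "w \<in> V" "w \<notin> A" using limbD[OF A(1)] by auto
  have fA: "limb E V (f w) b (f ` A)"
    using limb_image[OF A(1) inj f(2)] im f(3) by simp
  have rA: "realizes E (f ` A) b X"
    using realizes_image[OF A(2) inj_on_subset[OF inj AV(1)], of E] f(2,3) AV(1) by (auto simp: subset_iff)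
  have "f w = w"
  proof (rule ccontr)
    assume ne: "f w \<noteq> w"
    note DB = limbD[OF B(1)]
    have wfA: "w \<in> f ` A" using limb_cross(1)[OF fA, of b w] limbD(2)[OF fA] DB ne by metis
    have "(V - B) \<inter> f ` A = V - B"
    proof (rule connD[OF conn_limb_compl[OF conn B(1)]])
      show "w \<in> (V - B) \<inter> f ` A" using wfA DB by simp
      fix x y assume "x \<in> (V - B) \<inter> f ` A" "y \<in> V - B" "E x y"
      then show "y \<in> (V - B) \<inter> f ` A" using limb_cross(1)[OF fA, of x y] DB by blast
    qed auto
    then have "V \<subseteq> B \<union> f ` A" by auto
    then have "card V \<le> card (B \<union> f ` A)"
      using realizes_basic[OF B(2)] realizes_basic[OF rA] by (intro card_mono) auto
    also have "\<dots> \<le> card B + card (f ` A)" by (rule card_Un_le)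
    finally show False using large realizes_basic[OF B(2)] realizes_basic[OF rA] by simp
  qed
  then have "f ` A = B" using fA rA B by (metis limb_unique realizes_conn)
  then show ?thesis using rA B(2) by (blast intro: realizes_unique)
qed

subsection \<open>Undirected trees as realizations\<close>

abbreviation adj :: "'a pair_pre_digraph \<Rightarrow> 'a \<Rightarrow> 'a \<Rightarrow> bool" where
  "adj T x y \<equiv> (x, y) \<in> parcs T"

section \<open>Reachability and simple paths in pair digraphs\<close>

lemma pcas_last_in_verts: "pcas x es y \<Longrightarrow> y \<in> set (pawalk_verts x es)"
  by (induction es arbitrary: x) auto

lemma pcas_snoc:
  "pcas x es y \<Longrightarrow> pcas x (es @ [(y, p)]) p \<and> pawalk_verts x (es @ [(y, p)]) = pawalk_verts x es @ [p]"
  by (induction es arbitrary: x) auto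

lemma pcas_snocD:
  "pcas x (es @ [e]) p \<Longrightarrow> pcas x es (fst e) \<and> snd e = p \<and> pawalk_verts x (es @ [e]) = pawalk_verts x es @ [p]"
  by (induction es arbitrary: x) auto

lemma pcas_ends_distinct: "pcas x es y \<Longrightarrow> es \<noteq> [] \<Longrightarrow> distinct (pawalk_verts x es) \<Longrightarrow> x \<noteq> y"
  by (cases es) (auto dest: pcas_last_in_verts)

lemma pcas_suffix:
  "pcas z es y \<Longrightarrow> distinct (pawalk_verts z es) \<Longrightarrow> x \<in> set (pawalk_verts z es) \<Longrightarrow>
    \<exists>es'. pcas x es' y \<and> set es' \<subseteq> set es \<and> distinct (pawalk_verts x es') \<and>
      set (pawalk_verts x es') \<subseteq> set (pawalk_verts z es)"
proof (induction es arbitrary: z)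
  case Nil
  then show ?case by (intro exI[of _ "[]"]) auto
next
  case (Cons e es)
  show ?case
  proof (cases "x = z")
    case True
    then show ?thesis using Cons.prems by (intro exI[of _ "e # es"]) auto
  next
    case False
    then have "x \<in> set (pawalk_verts (snd e) es)" using Cons.prems by auto
    then obtain es' where "pcas x es' y" "set es' \<subseteq> set es" "distinct (pawalk_verts x es')"
      "set (pawalk_verts x es') \<subseteq> set (pawalk_verts (snd e) es)"
      using Cons.IH[of "snd e"] Cons.prems by auto
    then show ?thesis by (intro exI[of _ es']) auto
  qed
qed

text \<open>When the new first vertex already lies on the path, the path is cut down to its suffix
  from there.\<close>

lemma reach_imp_path:
  assumes "reach (adj T) S x y" "y \<in> S"
  shows "\<exists>es. pcas x es y \<and> set es \<subseteq> parcs T \<and> distinct (pawalk_verts x es) \<and> set (pawalk_verts x es) \<subseteq> S"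
  using assms(1) unfolding reach_def
proof (induction rule: converse_rtranclp_induct)
  case base
  show ?case using assms(2) by (intro exI[of _ "[]"]) auto
next
  case (step x z)
  then obtain es where es: "pcas z es y" "set es \<subseteq> parcs T" "distinct (pawalk_verts z es)"
    "set (pawalk_verts z es) \<subseteq> S" by blast
  show ?case
  proof (cases "x \<in> set (pawalk_verts z es)")
    case True
    then show ?thesis using pcas_suffix[OF es(1,3) True] es by (meson subset_trans)
  next
    case False
    then show ?thesis using es step by (intro exI[of _ "(x, z) # es"]) auto
  qed
qed

lemma path_imp_reach:
  assumes "pair_wf_digraph T"
  shows "pcas x es y \<Longrightarrow> set es \<subseteq> parcs T \<Longrightarrow> u \<notin> set (pawalk_verts x es) \<Longrightarrow> reach (adj T) (pverts T - {u}) x y"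
proof (induction es arbitrary: x)
  case Nil
  then show ?case by (simp add: reach_def)
next
  case (Cons e es)
  interpret pair_wf_digraph T by fact
  obtain z where e: "e = (x, z)" using Cons.prems by (cases e) auto
  have z: "z \<in> set (pawalk_verts z es)" by (cases es) (use Cons.prems e in auto)
  have "reach (adj T) (pverts T - {u}) z y" using Cons e by auto
  moreover have "x \<in> pverts T - {u}" "z \<in> pverts T - {u}" "adj T x z"
    using Cons.prems e z by (auto dest: in_arcsD1 in_arcsD2)
  ultimately show ?case unfolding reach_def
    using converse_rtranclp_into_rtranclp[of "\<lambda>x y. x \<in> pverts T - {u} \<and> y \<in> pverts T - {u} \<and> adj T x y" x z y]
    by blast
qed

lemma undirected_treeD:
  assumes "undirected_tree T"
  shows "finite (pverts T)" "pverts T \<noteq> {}" "conn (adj T) (pverts T)" "acy (adj T) (pverts T)"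
    "adj T x y \<Longrightarrow> adj T y x \<and> x \<noteq> y \<and> x \<in> pverts T \<and> y \<in> pverts T"
proof -
  have pg: "pair_graph T" and c: "connected (with_proj T)"
    and nocyc: "\<not> (\<exists>p. pre_digraph.cycle (with_proj T) p \<and> 3 \<le> length p)"
    using assms by (auto simp: undirected_tree_def)
  interpret pair_graph T by (rule pg)
  show "finite (pverts T)" by (rule pair_finite_verts)
  have sym: "adj T y x" if "adj T x y" for x y
    using that pair_sym_arcs unfolding symmetric_def with_proj_simps by (meson symD)
  then show "adj T x y \<Longrightarrow> adj T y x \<and> x \<noteq> y \<and> x \<in> pverts T \<and> y \<in> pverts T"
    using pair_no_loops[of "(x, y)"] in_arcsD1[of x y] in_arcsD2[of x y] by simp
  have rt: "pverts T \<noteq> {} \<and> (\<forall>u\<in>pverts T. \<forall>v\<in>pverts T. (u, v) \<in> rtrancl_on (pverts T) ((parcs T)\<^sup>s))"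
    using c connected_conv[of "with_proj T"] by simp
  then show "pverts T \<noteq> {}" by simp
  show "conn (adj T) (pverts T)"
    unfolding conn_def
  proof (intro allI impI)
    fix S assume S: "S \<subseteq> pverts T" "S \<noteq> {}" "\<forall>x\<in>S. \<forall>y\<in>pverts T. adj T x y \<longrightarrow> y \<in> S"
    then obtain s where s: "s \<in> S" by blast
    have "v \<in> S" if "v \<in> pverts T" for v
    proof -
      have "(s, v) \<in> rtrancl_on (pverts T) ((parcs T)\<^sup>s)" using rt s S that by blast
      then show ?thesis
      proof (induction rule: rtrancl_on_induct)
        case (step a b)
        then have "adj T a b" using sym by (auto simp: symcl_def)
        then show ?case using step S by blast
      qed (rule s)
    qed
    then show "S = pverts T" using S by blast
  qed
  show "acy (adj T) (pverts T)"
    unfolding acy_def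
  proof (intro ballI impI notI)
    fix p x y assume *: "p \<in> pverts T" "x \<in> pverts T" "y \<in> pverts T" "adj T p x" "adj T p y" "x \<noteq> y"
      "reach (adj T) (pverts T - {p}) x y"
    have "y \<noteq> p" using pair_no_loops[of "(p, y)"] *(5) by auto
    then obtain es where es: "pcas x es y" "set es \<subseteq> parcs T" "distinct (pawalk_verts x es)"
      "set (pawalk_verts x es) \<subseteq> pverts T - {p}"
      using reach_imp_path[OF *(7)] * by blast
    have "es \<noteq> []" using es *(6) by auto
    \<comment> \<open>The path between two neighbours of \<open>p\<close> closes up through
      \<open>p\<close>. It has at least one arc since \<open>x\<close> and \<open>y\<close> differ,
      so the cycle has length at least 3.\<close>
    let ?c = "(p, x) # es @ [(y, p)]"
    have "pre_digraph.cycle (with_proj T) ?c"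
      unfolding pre_digraph.cycle_def pre_digraph.awalk_def cas_with_proj_eq awalk_verts_with_proj_eq with_proj_simps
      using *(1,4,5) es pcas_snoc[OF es(1), of p] sym by (intro exI[of _ p]) auto
    moreover have "3 \<le> length ?c" using \<open>es \<noteq> []\<close> by (cases es) auto
    ultimately show False using nocyc by blast
  qed
qed

lemma undirected_treeI:
  assumes "realizes E V r t"
  defines "T \<equiv> \<lparr>pverts = V, parcs = {(x, y). x \<in> V \<and> y \<in> V \<and> E x y}\<rparr>"
  shows "undirected_tree T" "realizes (adj T) V r t"
proof -
  have fin: "finite V" and r: "r \<in> V" using realizes_basic[OF assms(1)] by auto
  have sym: "adj T y x \<and> x \<noteq> y" if "adj T x y" for x y
    using that realizes_sym[OF assms(1)] by (auto simp: T_def)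
  have "finite (V \<times> V)" using fin by simp
  then have "finite (parcs T)" by (rule rev_finite_subset) (auto simp: T_def)
  then have "pair_digraph T"
    using fin sym by unfold_locales (fastforce simp: T_def)+
  then interpret pair_digraph T .
  have "symmetric (with_proj T)"
    unfolding symmetric_def with_proj_simps using sym by (auto intro: symI)
  then interpret pair_graph T by unfold_locales
  have pg: "pair_graph T" by unfold_locales
  show rT: "realizes (adj T) V r t"
    using realizes_image[OF assms(1), of "\<lambda>x. x" "adj T"] by (simp add: T_def)
  have "(u, v) \<in> rtrancl_on V ((parcs T)\<^sup>s)" if "u \<in> V" "v \<in> V" for u v
  proof -
    have "{v \<in> V. (u, v) \<in> rtrancl_on V ((parcs T)\<^sup>s)} = V"
    proof (rule connD[OF realizes_conn[OF rT], of _ u])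
      fix x y assume "x \<in> {v \<in> V. (u, v) \<in> rtrancl_on V ((parcs T)\<^sup>s)}" "y \<in> V" "adj T x y"
      then show "y \<in> {v \<in> V. (u, v) \<in> rtrancl_on V ((parcs T)\<^sup>s)}"
        by (auto simp: symcl_def intro: rtrancl_on_into_rtrancl_on)
    qed (use that in auto)
    then show ?thesis using that by blast
  qed
  then have "connected (with_proj T)"
    unfolding connected_conv using r by (auto simp: T_def)
  moreover have "\<not> (\<exists>p. pre_digraph.cycle (with_proj T) p \<and> 3 \<le> length p)"
  proof
    assume "\<exists>p. pre_digraph.cycle (with_proj T) p \<and> 3 \<le> length p"
    then obtain p u where p: "3 \<le> length p" "u \<in> V" "set p \<subseteq> parcs T" "pcas u p u"
      "distinct (tl (pawalk_verts u p))"
      unfolding pre_digraph.cycle_def pre_digraph.awalk_def cas_with_proj_eq awalk_verts_with_proj_eq with_proj_simps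
      by (auto simp: T_def)
    \<comment> \<open>Removing the first and last arc, both at \<open>u\<close>, leaves a path
      \<open>es\<close> that avoids \<open>u\<close>. Length at least 3 makes it nonempty, so its
      ends are distinct neighbours of \<open>u\<close>, against acyclicity.\<close>
    obtain e1 q where q: "p = e1 # q" "length q \<ge> 2" using p(1) by (cases p) auto
    then obtain es e2 where e: "q = es @ [e2]" by (metis append_butlast_last_id list.size(3) not_numeral_le_zero)
    have "es \<noteq> []" using q e by auto
    define x where "x = snd e1" define y where "y = fst e2"
    have xes: "pcas x es y" "snd e2 = u" "pawalk_verts x q = pawalk_verts x es @ [u]" "fst e1 = u"
      using p(4) pcas_snocD[of x es e2 u] unfolding q e x_def y_def by auto
    have d: "distinct (pawalk_verts x es)" "u \<notin> set (pawalk_verts x es)"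
      using p(5) xes unfolding q x_def by auto
    have arcs: "adj T u x" "adj T y u" "set es \<subseteq> parcs T"
      using p(3) q e xes unfolding x_def y_def by (auto simp: prod_eq_iff) (metis prod.collapse)+
    have "reach (adj T) (pverts T - {u}) x y"
      by (rule path_imp_reach[OF _ xes(1) arcs(3) d(2)]) unfold_locales
    moreover have "x \<noteq> y" using pcas_ends_distinct[OF xes(1) \<open>es \<noteq> []\<close> d(1)] .
    moreover have "acy (adj T) (pverts T)" using realizes_acy[OF rT] by (simp add: T_def)
    ultimately show False using arcs sym in_arcsD1 in_arcsD2 unfolding acy_def by blast
  qed
  ultimately show "undirected_tree T" using pg by (simp add: undirected_tree_def)
qed

section \<open>Digraph isomorphisms as bijections of vertices, and cospectrality via
  \<open>cpoly\<close>\<close>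

lemma digraph_isoD:
  assumes "pre_digraph.digraph_isomorphism (with_proj S) f" "app_iso f (with_proj S) = with_proj T"
  shows "bij_betw (iso_verts f) (pverts S) (pverts T)"
    "x \<in> pverts S \<Longrightarrow> y \<in> pverts S \<Longrightarrow> adj S x y \<longleftrightarrow> adj T (iso_verts f x) (iso_verts f y)"
proof -
  let ?h = "iso_verts f"
  have inj: "inj_on ?h (pverts S)" and wf: "wf_digraph (with_proj S)"
    and ends: "\<And>a. a \<in> parcs S \<Longrightarrow> ?h (fst a) = iso_tail f (iso_arcs f a) \<and> ?h (snd a) = iso_head f (iso_arcs f a)"
    using assms(1) by (auto simp: pre_digraph.digraph_isomorphism_def)
  have im: "?h ` pverts S = pverts T" "iso_arcs f ` parcs S = parcs T" "iso_tail f = fst" "iso_head f = snd"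
    using assms(2) by (auto simp: app_iso_def with_proj_def)
  interpret pair_wf_digraph S using wf by (simp add: wf_digraph_wp_iff)
  show "bij_betw ?h (pverts S) (pverts T)" using inj im by (simp add: bij_betw_def)
  have arc: "iso_arcs f a = (?h (fst a), ?h (snd a))" if "a \<in> parcs S" for a
    using ends[OF that] im by (simp add: prod_eq_iff)
  assume xy: "x \<in> pverts S" "y \<in> pverts S"
  show "adj S x y \<longleftrightarrow> adj T (?h x) (?h y)"
  proof
    assume "adj S x y"
    then have "iso_arcs f (x, y) \<in> parcs T" using im by blast
    then show "adj T (?h x) (?h y)" using arc \<open>adj S x y\<close> by simp
  next
    assume "adj T (?h x) (?h y)"
    then obtain a where a: "a \<in> parcs S" "iso_arcs f a = (?h x, ?h y)" using im by (metis imageE)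
    then have "?h (fst a) = ?h x" "?h (snd a) = ?h y" using arc by auto
    then have "fst a = x" "snd a = y"
      using a xy inj arc_fst_in_verts arc_snd_in_verts by (auto simp: inj_on_eq_iff)
    then show "adj S x y" using a(1) by (metis prod.collapse)
  qed
qed

lemma digraph_isoI:
  assumes wf: "pair_wf_digraph S" "pair_wf_digraph T" and bij: "bij_betw f (pverts S) (pverts T)"
    and E: "\<And>x y. x \<in> pverts S \<Longrightarrow> y \<in> pverts S \<Longrightarrow> adj S x y \<longleftrightarrow> adj T (f x) (f y)"
  shows "digraph_iso (with_proj S) (with_proj T)"
proof -
  interpret S: pair_wf_digraph S by (rule wf)
  interpret T: pair_wf_digraph T by (rule wf)
  let ?h = "\<lparr>iso_verts = f, iso_arcs = map_prod f f, iso_head = snd, iso_tail = fst\<rparr>"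
  have inj: "inj_on f (pverts S)" and im: "f ` pverts S = pverts T" using bij by (auto simp: bij_betw_def)
  have sub: "parcs S \<subseteq> pverts S \<times> pverts S" using S.in_arcsD1 S.in_arcsD2 by auto
  have "inj_on (map_prod f f) (parcs S)"
    using map_prod_inj_on[OF inj inj] sub by (rule inj_on_subset)
  moreover have "map_prod f f ` parcs S = parcs T"
  proof (intro equalityI subsetI)
    fix a assume "a \<in> map_prod f f ` parcs S"
    then obtain x y where "a = (f x, f y)" "adj S x y" by auto
    then show "a \<in> parcs T" using E S.in_arcsD1 S.in_arcsD2 by blast
  next
    fix a assume a: "a \<in> parcs T"
    obtain u v where uv: "a = (u, v)" by (cases a)
    then have "u \<in> pverts T" "v \<in> pverts T" using a T.in_arcsD1 T.in_arcsD2 by auto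
    then obtain x y where "x \<in> pverts S" "u = f x" "y \<in> pverts S" "v = f y" using im by blast
    then have "(x, y) \<in> parcs S" "a = map_prod f f (x, y)" using a uv E by auto
    then show "a \<in> map_prod f f ` parcs S" by blast
  qed
  moreover have "wf_digraph (with_proj S)" using wf by (simp add: wf_digraph_wp_iff)
  ultimately have "pre_digraph.digraph_isomorphism (with_proj S) ?h \<and> with_proj T = app_iso ?h (with_proj S)"
    using inj im by (auto simp: pre_digraph.digraph_isomorphism_def app_iso_def with_proj_def)
  then show ?thesis unfolding digraph_iso_def by blast
qed

lemma cpoly_cong:
  assumes "\<And>x y. x \<in> V \<Longrightarrow> y \<in> V \<Longrightarrow> E x y \<longleftrightarrow> E' x y"
  shows "cpoly E V = cpoly E' V"
  unfolding cpoly_def set_det_def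
proof (intro sum.cong prod.cong arg_cong2[of _ _ _ _ times] refl)
  fix p v assume "p \<in> {p. p permutes V}" "v \<in> V"
  then show "char_entry E v (p v) = char_entry E' v (p v)"
    using assms[of v "p v"] by (simp add: char_entry_def permutes_in_image)
qed

lemma cospectral_vertsI:
  assumes "finite (pverts T)" "cpoly (adj T) (pverts T - {u}) = cpoly (adj T) (pverts T - {v})"
  shows "cospectral_verts T u v"
proof -
  have "graph_char_poly (pre_digraph.del_vert (with_proj T) w) = cpoly (adj T) (pverts T - {w})" for w
  proof -
    let ?D = "pre_digraph.del_vert (with_proj T) w"
    have D: "verts ?D = pverts T - {w}" "arcs_ends ?D = {(x, y) \<in> parcs T. x \<noteq> w \<and> y \<noteq> w}"
      by (auto simp: pre_digraph.del_vert_def arcs_ends_def arc_to_ends_def)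
    have "graph_char_poly ?D = cpoly (\<lambda>u v. (u, v) \<in> arcs_ends ?D) (verts ?D)"
      using assms(1) by (intro graph_char_poly_eq) (simp add: D)
    also have "\<dots> = cpoly (adj T) (pverts T - {w})"
      unfolding D by (rule cpoly_cong) auto
    finally show ?thesis .
  qed
  then show ?thesis using assms(2) by (simp add: cospectral_verts_def)
qed

subsection \<open>Cospectral branches\<close>

text \<open>When all branches share one pair of polynomials, the result depends only on their
  number. Hence \<open>F\<close> and \<open>G\<close> are chosen before \<open>M\<close>.\<close>

lemma cpolys_uniform:
  "\<exists>F G. \<forall>M. size M = n \<longrightarrow> (\<forall>c\<in>#M. cpolys c f g) \<longrightarrow> cpolys (Node M) F G"
proof (induction n)
  case 0
  then show ?case using cpolys.leaf by auto
next
  case (Suc n)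
  then obtain F G where IH: "\<And>M. size M = n \<Longrightarrow> (\<forall>c\<in>#M. cpolys c f g) \<Longrightarrow> cpolys (Node M) F G" by blast
  have "cpolys (Node M) (F * f - G * g) (G * f)" if M: "size M = Suc n" "\<forall>c\<in>#M. cpolys c f g" for M
  proof -
    obtain c N where "M = add_mset c N" using M(1) by (metis size_eq_Suc_imp_eq_union)
    then show ?thesis using cpolys.attach[OF IH[of N]] M by simp
  qed
  then show ?case by blast
qed

text \<open>
  The two rooted trees on nine vertices are one tree rooted at two cospectral vertices that are not similar.
\<close>
lemma cospectral_rooted_pair:
  obtains P Q f g where "P \<noteq> Q" "tree_size P = tree_size Q" "cpolys P f g" "cpolys Q f g"
proof -
  \<comment> \<open>Each \<open>p1\<close> to \<open>p5\<close> is a path rooted at an end. The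
    common tree is a path on eight vertices with a leaf attached to the third; \<open>P\<close> is
    rooted at the second vertex of the path and \<open>Q\<close> at the fifth.\<close>
  define p1 where "p1 = Node {#}"
  define p2 where "p2 = Node {#p1#}"
  define p3 where "p3 = Node {#p2#}"
  define p4 where "p4 = Node {#p3#}"
  define p5 where "p5 = Node {#p4#}"
  define P where "P = Node {#Node {#p5, p1#}, p1#}"
  define Q where "Q = Node {#Node {#Node {#p2, p1#}#}, p3#}"
  have 1: "cpolys p1 [:0, 1:] [:1:]" using cpolys.leaf by (simp add: p1_def one_pCons)
  note single = cpolys.attach[OF cpolys.leaf]
  have 2: "cpolys p2 [:-1, 0, 1:] [:0, 1:]" using single[OF 1] by (simp add: p2_def)
  have 3: "cpolys p3 [:0, -2, 0, 1:] [:-1, 0, 1:]" using single[OF 2] by (simp add: p3_def)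
  have 4: "cpolys p4 [:1, 0, -3, 0, 1:] [:0, -2, 0, 1:]" using single[OF 3] by (simp add: p4_def)
  have 5: "cpolys p5 [:0, 3, 0, -4, 0, 1:] [:1, 0, -3, 0, 1:]" using single[OF 4] by (simp add: p5_def)
  let ?f = "[:0, 4, 0, -17, 0, 20, 0, -8, 0, 1:]" and ?g = "[:0, 0, -4, 0, 10, 0, -6, 0, 1:]"
  have "cpolys P ?f ?g"
    using cpolys.attach[OF single[OF 1] cpolys.attach[OF single[OF 1] 5]] by (simp add: P_def)
  moreover have "cpolys Q ?f ?g"
    using cpolys.attach[OF single[OF 3] single[OF cpolys.attach[OF single[OF 1] 2]]] by (simp add: Q_def)
  moreover have "P \<noteq> Q" by (simp add: P_def Q_def p1_def p2_def p3_def p4_def p5_def add_eq_conv_ex)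
  moreover have "tree_size P = tree_size Q"
    by (simp add: P_def Q_def p1_def p2_def p3_def p4_def p5_def)
  ultimately show ?thesis using that by blast
qed

text \<open>Mixing \<open>i\<close> copies of \<open>P\<close> with \<open>k - i\<close> copies of
  \<open>Q\<close> keeps the number of branches, hence both polynomials and the size, while the
  multiplicity of \<open>P\<close> tells the trees apart.\<close>

lemma cospectral_rooted_family:
  obtains X f g s where "inj_on X {..<k::nat}" "\<forall>i<k. cpolys (X i) f g" "\<forall>i<k. tree_size (X i) = s"
proof -
  obtain P Q f g where PQ: "P \<noteq> Q" "tree_size P = tree_size Q" "cpolys P f g" "cpolys Q f g"
    using cospectral_rooted_pair .
  define M where "M i = replicate_mset i P + replicate_mset (k - i) Q" for i
  obtain F G where FG: "\<And>N. size N = k \<Longrightarrow> (\<forall>c\<in>#N. cpolys c f g) \<Longrightarrow> cpolys (Node N) F G"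
    using cpolys_uniform[of k f g] by blast
  have "count (M i) P = i" for i using PQ(1) by (simp add: M_def)
  then have "inj (\<lambda>i. Node (M i))" by (metis injI rtree.inject)
  then have "inj_on (\<lambda>i. Node (M i)) {..<k}" by (rule inj_on_subset) simp
  moreover have "\<forall>i<k. cpolys (Node (M i)) F G"
    using PQ by (auto intro!: FG simp: M_def split: if_splits)
  moreover have "\<forall>i<k. tree_size (Node (M i)) = Suc (k * tree_size P)"
    using PQ(2) by (simp add: M_def flip: add_mult_distrib)
  ultimately show ?thesis by (rule that)
qed

text \<open>The vertices are the roots \<open>c i\<close> of the branches below one vertex
  \<open>w\<close>. They are distinct because a shared root would force equal limbs and so equal
  \<open>X i\<close>. The assumption \<open>large\<close> serves
  \<open>limbs_not_similar\<close>.\<close>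

lemma has_nonsimilar_cospectral_vertsI:
  fixes T :: "'a::linorder pair_pre_digraph"
  assumes T: "undirected_tree T" and t: "realizes (adj T) (pverts T) r t"
    and X: "inj_on X {..<k}" "\<And>i. i < k \<Longrightarrow> cpolys (X i) f g" "\<And>i. i < k \<Longrightarrow> tree_size (X i) = s"
    and L: "Node (image_mset X (mset_set {..<k})) \<in> subtrees t" and large: "2 * s < card (pverts T)"
  shows "has_nonsimilar_cospectral_verts k T"
proof -
  let ?V = "pverts T" and ?E = "adj T"
  have fin: "finite ?V" and conn: "conn ?E ?V" using undirected_treeD[OF T] by auto
  from realizes_subtree[OF t L] obtain w where
    w: "\<forall>Y\<in>#image_mset X (mset_set {..<k}). \<exists>A c. limb ?E ?V w c A \<and> realizes ?E A c Y \<and> r \<notin> A"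
    by blast
  have "\<exists>A c. limb ?E ?V w c A \<and> realizes ?E A c (X i)" if "i < k" for i
    using bspec[OF w, of "X i"] that by auto
  then obtain A c where Ac: "\<And>i. i < k \<Longrightarrow> limb ?E ?V w (c i) (A i)" "\<And>i. i < k \<Longrightarrow> realizes ?E (A i) (c i) (X i)"
    by metis
  have inj: "i = j" if "i < k" "j < k" "c i = c j" for i j
  proof -
    have "A i = A j"
      using limb_unique[OF Ac(1)[OF that(1)] realizes_conn[OF Ac(2)[OF that(1)]]]
        Ac(1)[OF that(2)] realizes_conn[OF Ac(2)[OF that(2)]] that(3) by simp
    then have "X i = X j" using realizes_unique[OF Ac(2)[OF that(1)]] Ac(2)[OF that(2)] that(3) by simp
    then show ?thesis using X(1) that by (auto dest: inj_onD)
  qed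
  have "cospectral_verts T (c i) (c j) \<and> \<not> similar_verts T (c i) (c j)" if ij: "i < k" "j < k" "c i \<noteq> c j" for i j
  proof
    show "cospectral_verts T (c i) (c j)"
      by (rule cospectral_vertsI[OF fin limbs_cospectral[OF fin Ac(1,2)[OF ij(1)] X(2)[OF ij(1)]
        Ac(1,2)[OF ij(2)] X(2)[OF ij(2)] ij(3)]])
    show "\<not> similar_verts T (c i) (c j)"
    proof
      assume "similar_verts T (c i) (c j)"
      then obtain h where h: "pre_digraph.digraph_isomorphism (with_proj T) h"
        "app_iso h (with_proj T) = with_proj T" "iso_verts h (c i) = c j"
        by (auto simp: similar_verts_def)
      have "X i = X j"
        by (rule limbs_not_similar[OF fin conn Ac(1,2)[OF ij(1)] Ac(1,2)[OF ij(2)] digraph_isoD[OF h(1,2)] h(3)])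
          (use X(3) ij large in auto)
      then show False using X(1) ij by (auto dest: inj_onD)
    qed
  qed
  moreover have "c ` {..<k} \<subseteq> ?V" using Ac(1) limbD(1,2) by fast
  moreover have "card (c ` {..<k}) = k"
    using inj by (subst card_image) (auto intro: inj_onI)
  ultimately show ?thesis
    unfolding has_nonsimilar_cospectral_verts_def by (intro exI[of _ "c ` {..<k}"]) auto
qed

subsection \<open>From rooted trees to isomorphism classes\<close>

lemma trees_realize:
  assumes "T \<in> trees n" "r < n"
  shows "\<exists>t \<in> rooted_trees n. realizes (adj T) {..<n} r t"
proof -
  have T: "undirected_tree T" and V: "pverts T = {..<n}" using assms by (auto simp: trees_def)
  note D = undirected_treeD[OF T]
  have "\<exists>t. realizes (adj T) (pverts T) r t"
    by (rule realizes_exists[OF D(1) _ D(3,4)]) (use D(5) V assms(2) in auto)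
  then obtain t where t: "realizes (adj T) (pverts T) r t" by blast
  then show ?thesis using realizes_basic[OF t] V by (auto simp: rooted_trees_def)
qed

lemma trees_wf: "T \<in> trees n \<Longrightarrow> pair_wf_digraph T"
  by (simp add: trees_def undirected_tree_def pair_graph_def pair_digraph_def pair_fin_digraph_def)

lemma tree_isoI:
  assumes "S \<in> trees n" "T \<in> trees n" "realizes (adj S) {..<n} r t" "realizes (adj T) {..<n} r' t"
  shows "(S, T) \<in> tree_iso n"
proof -
  obtain f where f: "bij_betw f {..<n} {..<n}" "\<forall>x\<in>{..<n}. \<forall>y\<in>{..<n}. adj S x y \<longleftrightarrow> adj T (f x) (f y)"
    using realizes_iso[OF assms(3,4)] by blast
  have V: "pverts S = {..<n}" "pverts T = {..<n}" using assms by (auto simp: trees_def)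
  have "digraph_iso (with_proj S) (with_proj T)"
    by (rule digraph_isoI[of _ _ f]) (use assms trees_wf f V in auto)
  then show ?thesis using assms by (simp add: tree_iso_def)
qed

lemma quotient_image: "A // R = (\<lambda>x. R `` {x}) ` A"
  by (auto simp: quotient_def)

text \<open>Each tree is coded by its rooted tree at vertex \<open>0\<close>. Trees with equal codes
  are isomorphic, so \<open>h\<close> recovers the class from the code through any
  representative.\<close>

lemma card_tree_classes_le:
  assumes "n \<ge> 1" "A \<subseteq> trees n" "finite R"
    and R: "\<And>T t. T \<in> A \<Longrightarrow> realizes (adj T) {..<n} 0 t \<Longrightarrow> t \<in> R"
  shows "finite (A // tree_iso n)" "card (A // tree_iso n) \<le> card R"
proof -
  have "\<forall>T\<in>A. \<exists>t. realizes (adj T) {..<n} 0 t"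
    using trees_realize[of _ n 0] assms(1,2) by fastforce
  then obtain code where code: "\<And>T. T \<in> A \<Longrightarrow> realizes (adj T) {..<n} 0 (code T)" by metis
  define h where "h t = tree_iso n `` {inv_into A code t}" for t
  have "tree_iso n `` {T} = h (code T)" if "T \<in> A" for T
  proof -
    define S where "S = inv_into A code (code T)"
    have S: "S \<in> A" "code S = code T" using that by (auto simp: S_def inv_into_into f_inv_into_f)
    have "(T, S) \<in> tree_iso n"
      using tree_isoI[OF _ _ code[OF that], of S] code[OF S(1)] S assms(2) that by auto
    then show ?thesis unfolding h_def S_def[symmetric]
      by (rule equiv_class_eq[OF equiv_tree_iso])
  qed
  then have eq: "A // tree_iso n = h ` code ` A" by (auto simp: quotient_image)
  have sub: "code ` A \<subseteq> R" using R code by blast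
  then have "finite (code ` A)" using assms(3) by (rule finite_subset)
  then show "finite (A // tree_iso n)" "card (A // tree_iso n) \<le> card R"
    unfolding eq using card_image_le[of "code ` A" h] card_mono[OF assms(3) sub] by auto
qed

lemma finite_tree_classes:
  assumes "n \<ge> 1"
  shows "finite (trees n // tree_iso n)"
proof (rule card_tree_classes_le(1)[OF assms])
  fix T t assume "realizes (adj T) {..<n} 0 t"
  then show "t \<in> rooted_trees n" using realizes_basic[of "adj T" "{..<n}" 0 t] by (simp add: rooted_trees_def)
qed auto

text \<open>Every rooted tree arises from a chosen representative of a class by rooting it at one of
  its \<open>n\<close> vertices, and by \<open>realizes_unique\<close> class and vertex determine
  it.\<close>

lemma card_rooted_trees_le_classes:
  assumes "n \<ge> 1"
  shows "card (rooted_trees n) \<le> n * card (trees n // tree_iso n)"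
proof -
  define rep where "rep Q = (SOME T. T \<in> Q)" for Q :: "nat pair_pre_digraph set"
  have "\<exists>Qv \<in> (trees n // tree_iso n) \<times> {..<n}. realizes (adj (rep (fst Qv))) {..<n} (snd Qv) t"
    if t: "t \<in> rooted_trees n" for t
  proof -
    have n: "tree_size t = n" using t by (simp add: rooted_trees_def)
    obtain E where E: "realizes E {..<n} 0 t" using realization_exists[of t] n by auto
    define T where "T = \<lparr>pverts = {..<n}, parcs = {(x, y). x \<in> {..<n} \<and> y \<in> {..<n} \<and> E x y}\<rparr>"
    have T: "T \<in> trees n" "realizes (adj T) {..<n} 0 t"
      using undirected_treeI[OF E] by (auto simp: T_def trees_def)
    define Q where "Q = tree_iso n `` {T}"
    have "T \<in> Q" using equiv_class_self[OF equiv_tree_iso T(1)] by (simp add: Q_def)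
    then have "rep Q \<in> Q" unfolding rep_def by (rule someI)
    then have "digraph_iso (with_proj T) (with_proj (rep Q))" "rep Q \<in> trees n"
      by (auto simp: Q_def tree_iso_def)
    then obtain f where f: "pre_digraph.digraph_isomorphism (with_proj T) f"
      "app_iso f (with_proj T) = with_proj (rep Q)" by (auto simp: digraph_iso_def)
    have V: "pverts T = {..<n}" "pverts (rep Q) = {..<n}"
      using T(1) \<open>rep Q \<in> trees n\<close> by (auto simp: trees_def)
    note iso = digraph_isoD[OF f, unfolded V]
    have "realizes (adj (rep Q)) (iso_verts f ` {..<n}) (iso_verts f 0) t"
      by (rule realizes_image[OF T(2)]) (use iso in \<open>auto simp: bij_betw_def\<close>)
    moreover have "iso_verts f ` {..<n} = {..<n}" using iso(1) by (simp add: bij_betw_def)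
    moreover have "Q \<in> trees n // tree_iso n" using T(1) unfolding Q_def by (rule quotientI)
    ultimately show ?thesis using assms by (intro bexI[of _ "(Q, iso_verts f 0)"]) auto
  qed
  then have "\<forall>t\<in>rooted_trees n. \<exists>Qv. Qv \<in> (trees n // tree_iso n) \<times> {..<n} \<and>
    realizes (adj (rep (fst Qv))) {..<n} (snd Qv) t" by blast
  from bchoice[OF this] obtain F where F: "\<forall>t\<in>rooted_trees n. F t \<in> (trees n // tree_iso n) \<times> {..<n} \<and>
    realizes (adj (rep (fst (F t)))) {..<n} (snd (F t)) t" by blast
  have "inj_on F (rooted_trees n)"
  proof (rule inj_onI)
    fix t t' assume "t \<in> rooted_trees n" "t' \<in> rooted_trees n" "F t = F t'"
    then show "t = t'" using F realizes_unique[of "adj (rep (fst (F t)))" "{..<n}" "snd (F t)" t t'] by auto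
  qed
  then have "card (rooted_trees n) \<le> card ((trees n // tree_iso n) \<times> {..<n})"
    by (rule card_inj_on_le) (use F finite_tree_classes[OF assms] in auto)
  then show ?thesis by (simp add: card_cartesian_product mult.commute)
qed

theorem corollary7p9:
  fixes k :: nat
  assumes "k \<ge> 2"
  shows "tree_proportion (has_nonsimilar_cospectral_verts k) \<longlonglongrightarrow> 1"
proof -
  obtain X f g s where X: "inj_on X {..<k}" "\<forall>i<k. cpolys (X i) f g"
    "\<forall>i<k. tree_size (X i) = s" using cospectral_rooted_family[where k = k] .
  define L where "L = Node (image_mset X (mset_set {..<k}))"
  define P where "P = (has_nonsimilar_cospectral_verts k :: nat pair_pre_digraph \<Rightarrow> bool)"
  define a where "a n = card {t \<in> rooted_trees n. L \<notin> subtrees t}" for n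
  define \<epsilon> where "\<epsilon> n = real n * real (a n) / real (card (rooted_trees n))" for n
  have "\<epsilon> \<longlonglongrightarrow> 0" unfolding \<epsilon>_def a_def by (rule avoiding_negligible)
  \<comment> \<open>The threshold makes the host more than twice as large as a branch of
    \<open>L\<close>.\<close>
  moreover have "norm (tree_proportion P n - 1) \<le> \<epsilon> n" if n: "n \<ge> 2 * s + 1" for n
  proof -
    let ?G = "{T \<in> trees n. P T}" and ?B = "{T \<in> trees n. \<not> P T}" and ?R = "tree_iso n"
    define c where "c = card (trees n // ?R)"
    have n1: "n \<ge> 1" using n by simp
    have fin: "finite (trees n // ?R)" by (rule finite_tree_classes[OF n1])
    have un: "trees n // ?R = ?G // ?R \<union> ?B // ?R" by (auto simp: quotient_image)
    \<comment> \<open>A tree without the property avoids \<open>L\<close> when rooted at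
      \<open>0\<close>, so its class is among those counted by \<open>a n\<close>.\<close>
    have B: "card (?B // ?R) \<le> a n"
      unfolding a_def
    proof (rule card_tree_classes_le[OF n1])
      fix T t assume T: "T \<in> ?B" and t: "realizes (adj T) {..<n} 0 t"
      have V: "pverts T = {..<n}" and ut: "undirected_tree T" using T by (auto simp: trees_def)
      have "L \<notin> subtrees t"
      proof
        assume "L \<in> subtrees t"
        then have "P T"
          unfolding P_def L_def using has_nonsimilar_cospectral_vertsI[OF ut _ X(1) X(2,3)[rule_format]] t V n by simp
        then show False using T by simp
      qed
      then show "t \<in> {t \<in> rooted_trees n. L \<notin> subtrees t}"
        using realizes_basic[OF t] by (simp add: rooted_trees_def)
    qed auto
    have "card (rooted_trees n) \<le> n * c" unfolding c_def by (rule card_rooted_trees_le_classes[OF n1])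
    then have t: "real (card (rooted_trees n)) \<le> real n * real c" by (metis of_nat_le_iff of_nat_mult)
    have t0: "real (card (rooted_trees n)) > 0" using card_rooted_trees_pos[OF n1] by simp
    have c0: "real c > 0" using t t0 by (cases "c = 0") auto
    have "card (?G // ?R) \<le> c" unfolding c_def using fin un by (intro card_mono) auto
    moreover have "c \<le> card (?G // ?R) + card (?B // ?R)" unfolding c_def un by (rule card_Un_le)
    ultimately have "\<bar>real (card (?G // ?R)) - real c\<bar> \<le> real (card (?B // ?R))" by linarith
    moreover have "tree_proportion P n - 1 = (real (card (?G // ?R)) - real c) / real c"
      using c0 by (simp add: tree_proportion_def c_def[symmetric] diff_divide_distrib)
    ultimately have "norm (tree_proportion P n - 1) \<le> real (card (?B // ?R)) / real c"
      using c0 by (simp add: abs_divide divide_right_mono)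
    also have "\<dots> \<le> real (a n) / real c" using B c0 by (simp add: divide_right_mono)
    \<comment> \<open>Expanding by \<open>n\<close> makes the denominator at least the number of
      rooted trees; here the factor \<open>n\<close> of \<open>avoiding_negligible\<close> is
      spent.\<close>
    also have "\<dots> = real n * real (a n) / (real n * real c)" using n1 by simp
    also have "\<dots> \<le> \<epsilon> n" unfolding \<epsilon>_def using t t0 by (intro divide_left_mono) auto
    finally show ?thesis .
  qed
  then have "eventually (\<lambda>n. norm (tree_proportion P n - 1) \<le> norm (\<epsilon> n) * 1) sequentially"
    unfolding eventually_sequentially by (metis abs_ge_self mult_1_right order_trans real_norm_def)
  ultimately have "(\<lambda>n. tree_proportion P n - 1) \<longlonglongrightarrow> 0" by (rule tendsto_0_le)
  then show ?thesis unfolding P_def by (rule LIM_zero_cancel)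
qed

end
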